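(* Let $p(x) = \sum_{i=0}^t c_i x^{t-i} \in \mathbb{Z}[x]$ be a monic polynomial whose distinct non-zero complex roots are $r_1, \dots, r_n$, indexed so that $|r_1| \geq |r_2| \geq \dots \geq |r_n| > 0$, and let $\mathbf{m} = \langle \mathbf{m}_1, \dots, \mathbf{m}_n\rangle^T$ be the vector of their multiplicities. Let \begin{itemize} \item $M = \max\{\max_{i,j} |r_i - r_j|,\ 1\}$ and $m = \min\{\min_{i \neq j} |r_i - r_j|,\ 1\}$, \item $R = \max\{|r_1|, 1\}$ and $r = \min\{|r_n|, 1\}$, \item $c = \max\{\max_{1 \le i \le n} |c_i|,\ 1\}$. \end{itemize} If each root $r_i$ is approximated by a disk $D_i = D(r_i,\epsilon)$ of radius $\epsilon > 0$ such that \[ \epsilon < \frac{m^2 r}{2^{2n+7} n^5} \left( \frac{m}{MRc} \right)^n , \] then for each $i \in \{1,\dots,n\}$ the disk approximating $\mathbf{m}_i = \big((\Lambda C V_0)^{-1} \mathbf{c}\big)_i \in \mathbb{Z}$ that results from the disk-arithmetic computation described in the context contains exactly one integer.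
   Context: Disk arithmetic. $D(z,\epsilon)$ is the open disk in $\mathbb{C}$ with center $z$ and radius $\epsilon$; an exact number is treated as a disk of radius $0$. For $A = D(a, \rho_1)$, $B = D(b, \rho_2)$: \[ A \pm B = D(a \pm b, \rho_1 + \rho_2), \quad AB = D(ab, |a|\rho_2 + |b|\rho_1 + \rho_1\rho_2), \quad \frac1B = D\!\left( \frac{\bar b}{|b|^2 - \rho_2^2}, \frac{\rho_2}{|b|^2 - \rho_2^2} \right), \] the last when $|b|>\rho_2$. Matrices. With $c_0 = 1$: $\mathbf{c} = \langle c_1, \dots, c_n \rangle^T$; $\Lambda = -\operatorname{diag}(1, 1/2, \dots, 1/n)$; $C$ is the $n \times n$ lower triangular matrix with $C_{i,j} = c_{i-j}$ for $i \ge j$ and $0$ otherwise; $V$ is the Vandermonde matrix $V_{i,j} = r_j^{\,i-1}$, $1 \le i,j \le n$; and $V_0 = V \operatorname{diag}(r_1, \dots, r_n)$. The vector of multiplicities satisfies $\mathbf{m} = (\Lambda C V_0)^{-1}\mathbf{c} = V_0^{-1} C^{-1} \Lambda^{-1} \mathbf{c}$. The entries of $C^{-1}$, $\Lambda^{-1}$ and $\mathbf{c}$ are integers and are treated as exact. The computation. One uses the decomposition $V^{-1} = \Delta W L$, where $\Delta$ is diagonal with $\Delta_{i,i} = \prod_{k=1, k\neq i}^n \frac{1}{r_i - r_k}$; $W_{i,j} = 0$ for $i > j$ and $W_{i,j} = \prod_{k=j+1,\, k \ne i}^n (r_i - r_k)$ otherwise; and $L_{i,j} = 0$ for $i<j$,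 $L_{i,i} = 1$, and $L_{i,j} = L_{i-1,j-1} - L_{i-1,j}\, r_{i-1}$ for $i > j \ge 1$ (with $L_{i,0} = 0$). In these formulas each $r_i$ is replaced by the disk $D_i$ and each operation by the corresponding disk operation, giving disks for the entries of $\Delta$, $W$, $L$. One then computes with disk arithmetic, in this order, $\Delta W$, then $V^{-1} = (\Delta W)L$, then $V_0^{-1} = \operatorname{diag}(r_1,\dots,r_n)^{-1} V^{-1}$ (again with $r_i$ replaced by $D_i$), then $V_0^{-1}C^{-1}$, then $(V_0^{-1}C^{-1})\Lambda^{-1}$, and finally $(V_0^{-1}C^{-1}\Lambda^{-1})\mathbf{c}$, whose $i$-th entry is the disk approximating $\mathbf{m}_i$. If $n = 1$, set $m = 1$. *)

theory Defs
  imports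
    "Jordan_Normal_Form.Gauss_Jordan_Elimination"
    "HOL-Analysis.Elementary_Metric_Spaces"
    "HOL-Computational_Algebra.Polynomial"
begin

datatype disk = Disk (center: complex) (radius: real)

(* Empty for radius 0: exact numbers occur as operands only. *)
definition disk_set :: "disk \<Rightarrow> complex set" where
  "disk_set A = ball (center A) (radius A)"

definition exact :: "complex \<Rightarrow> disk" where
  "exact z = Disk z 0"

instantiation disk :: comm_monoid_add
begin

definition zero_disk :: disk where
  "0 = exact 0"

definition plus_disk :: "disk \<Rightarrow> disk \<Rightarrow> disk" where
  "A + B = Disk (center A + center B) (radius A + radius B)"

instance
  by standard (simp_all add: plus_disk_def zero_disk_def exact_def algebra_simps)

end

instantiation disk :: comm_monoid_mult
begin

definition one_disk :: disk where
  "1 = exact 1"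

definition times_disk :: "disk \<Rightarrow> disk \<Rightarrow> disk" where
  "A * B = Disk (center A * center B)
     (cmod (center A) * radius B + cmod (center B) * radius A + radius A * radius B)"

instance
  by standard
    (simp_all add: times_disk_def one_disk_def exact_def norm_mult algebra_simps)

end

instantiation disk :: minus
begin

definition minus_disk :: "disk \<Rightarrow> disk \<Rightarrow> disk" where
  "A - B = Disk (center A - center B) (radius A + radius B)"

instance ..

end

(* Left undefined when the closed disk contains 0, so nothing can be concluded from a
   computation that inverts such a disk. *)
definition recip :: "disk \<Rightarrow> disk" where
  "recip B = (if cmod (center B) > radius B
     then Disk (cnj (center B) / of_real ((cmod (center B))\<^sup>2 - (radius B)\<^sup>2))
               (radius B / ((cmod (center B))\<^sup>2 - (radius B)\<^sup>2))
     else undefined)"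

(* The matrix product of the library needs a semiring; disk arithmetic is not distributive. *)
definition disk_mat_mult :: "disk mat \<Rightarrow> disk mat \<Rightarrow> disk mat" (infixl "**\<^sub>D" 70) where
  "A **\<^sub>D B = mat (dim_row A) (dim_col B) (\<lambda>(i, j). \<Sum>k<dim_col A. A $$ (i, k) * B $$ (k, j))"

definition disk_mat_vec :: "disk mat \<Rightarrow> disk vec \<Rightarrow> disk vec" (infixl "*v\<^sub>D" 70) where
  "A *v\<^sub>D v = vec (dim_row A) (\<lambda>i. \<Sum>k<dim_col A. A $$ (i, k) * v $ k)"

(* Entry formulas are written with indices 1..n, whereas library vectors and matrices are
   indexed from 0. *)
definition vec1 :: "nat \<Rightarrow> (nat \<Rightarrow> 'a) \<Rightarrow> 'a vec" where
  "vec1 n f = vec n (\<lambda>i. f (Suc i))"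

definition mat1 :: "nat \<Rightarrow> (nat \<Rightarrow> nat \<Rightarrow> 'a) \<Rightarrow> 'a mat" where
  "mat1 n f = mat n n (\<lambda>(i, j). f (Suc i) (Suc j))"

definition diag1 :: "nat \<Rightarrow> (nat \<Rightarrow> 'a::zero) \<Rightarrow> 'a mat" where
  "diag1 n f = mat_diag n (\<lambda>i. f (Suc i))"

(* Meaningful for invertible matrices only. *)
definition inv_mat :: "complex mat \<Rightarrow> complex mat" where
  "inv_mat A = the (mat_inverse A)"

definition c_vec :: "nat \<Rightarrow> (nat \<Rightarrow> int) \<Rightarrow> complex vec" where
  "c_vec n c = vec1 n (\<lambda>i. of_int (c i))"

definition Lambda_mat :: "nat \<Rightarrow> complex mat" where
  "Lambda_mat n = diag1 n (\<lambda>i. - (1 / of_nat i))"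

definition C_mat :: "nat \<Rightarrow> (nat \<Rightarrow> int) \<Rightarrow> complex mat" where
  "C_mat n c = mat1 n (\<lambda>i j. if i \<ge> j then of_int (c (i - j)) else 0)"

definition V_mat :: "nat \<Rightarrow> (nat \<Rightarrow> complex) \<Rightarrow> complex mat" where
  "V_mat n r = mat1 n (\<lambda>i j. r j ^ (i - 1))"

definition V0_mat :: "nat \<Rightarrow> (nat \<Rightarrow> complex) \<Rightarrow> complex mat" where
  "V0_mat n r = V_mat n r * diag1 n r"

definition Delta_disk :: "nat \<Rightarrow> (nat \<Rightarrow> disk) \<Rightarrow> nat \<Rightarrow> disk" where
  "Delta_disk n D i = (\<Prod>k\<in>{1..n} - {i}. recip (D i - D k))"

definition W_disk :: "nat \<Rightarrow> (nat \<Rightarrow> disk) \<Rightarrow> nat \<Rightarrow> nat \<Rightarrow> disk" where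
  "W_disk n D i j = (if i > j then 0 else \<Prod>k\<in>{j+1..n} - {i}. D i - D k)"

fun L_disk :: "(nat \<Rightarrow> disk) \<Rightarrow> nat \<Rightarrow> nat \<Rightarrow> disk" where
  "L_disk D i 0 = 0"
| "L_disk D 0 (Suc j) = 0"
| "L_disk D (Suc i) (Suc j) =
     (if i < j then 0 else if i = j then 1 else L_disk D i j - L_disk D i (Suc j) * D i)"

definition V_inv_disk :: "nat \<Rightarrow> (nat \<Rightarrow> disk) \<Rightarrow> disk mat" where
  "V_inv_disk n D =
     (diag1 n (Delta_disk n D) **\<^sub>D mat1 n (W_disk n D)) **\<^sub>D mat1 n (L_disk D)"

definition V0_inv_disk :: "nat \<Rightarrow> (nat \<Rightarrow> disk) \<Rightarrow> disk mat" where
  "V0_inv_disk n D = diag1 n (\<lambda>i. recip (D i)) **\<^sub>D V_inv_disk n D"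

definition multiplicity_disks :: "nat \<Rightarrow> (nat \<Rightarrow> int) \<Rightarrow> (nat \<Rightarrow> disk) \<Rightarrow> disk vec" where
  "multiplicity_disks n c D =
     ((V0_inv_disk n D **\<^sub>D map_mat exact (inv_mat (C_mat n c)))
        **\<^sub>D map_mat exact (inv_mat (Lambda_mat n)))
        *v\<^sub>D map_vec exact (c_vec n c)"

end

theory Submission
  imports Defs
    "Jordan_Normal_Form.Determinant"
    "HOL-Computational_Algebra.Polynomial_Factorial"
    "HOL-Computational_Algebra.Fundamental_Theorem_Algebra"
    "HOL-Computational_Algebra.Polynomial_FPS"
begin

text \<open>
  Disk arithmetic is inclusion isotonic, and the exact computation returns the multiplicities:
  Newton's identities express \<open>\<Lambda>\<^sup>-\<^sup>1 c\<close> as \<open>C\<close> applied to the power sums, which are \<open>V\<^sub>0 m\<close>, and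
  \<open>\<Delta> W L\<close> inverts \<open>V\<close> because the rows of \<open>L\<close> are the coefficients of the Newton basis. So
  it suffices that the final radius is positive and at most \<open>1/2\<close>. For the upper bound every disk is
  tracked by a pair \<open>(a, x)\<close> with \<open>\<bar>center\<bar> + radius \<le> a x\<close> and
  \<open>radius \<le> a (x - 1)\<close>, where \<open>a\<close> and \<open>x\<close> multiply along products. The
  factor \<open>r\<close> in the hypothesis pays for only one of the two powers of \<open>1/r\<close> in the error of
  \<open>1/D\<^sub>n\<close>; the other is paid for by \<open>M\<close> and \<open>R\<close>, since some set of distinct nonzero
  roots containing \<open>r\<^sub>n\<close>, namely the roots of an irreducible factor of \<open>p\<close>, has a product
  of modulus at least \<open>1\<close>.
\<close>

section \<open>Disk arithmetic\<close>

text \<open>(M R)^n in the hypothesis is max(M,R)^n min(M,R)^n. The entries of \<Delta> W L grow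
  like (max(M,R)/m)^(n-1), because M enters through W and R through L, so only powers of min(M,R)
  are left for the lower bound on the smallest root. That bound must therefore hold with M as well
  as with R, although differences of roots do not bound the roots themselves: a root of modulus at
  most 1/n puts all others within M + 1/n of 0, and (1 + 1/n)^(n-1) \<le> n. The 2^(2n) has to beat
  3^n, which bounds the sum over k of (n choose k+1) 2^(k+1); the binomials come from the
  coefficients of the Newton basis and the powers of 2 from C^-1. Positivity of the final radius
  needs its own argument, since a disk of radius 0 is an empty open ball.\<close>

lemma disk_zero_simps [simp]: "center 0 = 0" "radius 0 = 0"
  by (simp_all add: zero_disk_def exact_def)

lemma disk_one_simps [simp]: "center 1 = 1" "radius 1 = 0"
  by (simp_all add: one_disk_def exact_def)

lemma disk_plus_simps [simp]:
  "center (A + B) = center A + center B" "radius (A + B) = radius A + radius B"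
  by (simp_all add: plus_disk_def)

lemma disk_minus_simps [simp]:
  "center (A - B) = center A - center B" "radius (A - B) = radius A + radius B"
  by (simp_all add: minus_disk_def)

lemma disk_times_simps [simp]:
  "center (A * B) = center A * center B"
  "radius (A * B) = cmod (center A) * radius B + cmod (center B) * radius A + radius A * radius B"
  by (simp_all add: times_disk_def)

lemma exact_simps [simp]: "center (exact z) = z" "radius (exact z) = 0"
  by (simp_all add: exact_def)

lemma disk_mult_zero [simp]: "(0 :: disk) * A = 0" "A * (0 :: disk) = 0"
  by (simp_all add: disk.expand)

lemma radius_sum: "radius (sum f S) = (\<Sum>k\<in>S. radius (f k))"
  by (induction S rule: infinite_finite_induct) auto

lemma recip_simps:
  assumes "radius B < cmod (center B)"
  shows "center (recip B) = cnj (center B) / of_real ((cmod (center B))\<^sup>2 - (radius B)\<^sup>2)"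
    and "radius (recip B) = radius B / ((cmod (center B))\<^sup>2 - (radius B)\<^sup>2)"
  using assms by (simp_all add: recip_def)

text \<open>Membership in the open disk, except that an exact number contains its center.\<close>

definition approx :: "complex \<Rightarrow> disk \<Rightarrow> bool" where
  "approx z A \<longleftrightarrow>
     cmod (z - center A) \<le> radius A \<and> (radius A \<noteq> 0 \<longrightarrow> cmod (z - center A) < radius A)"

lemma approx_exact [simp]: "approx z (exact z)"
  by (simp add: approx_def)

lemma approx_zero [simp]: "approx 0 0"
  by (simp add: approx_def)

lemma approx_one [simp]: "approx 1 1"
  by (simp add: approx_def)

lemma approx_radius_nonneg: "approx z A \<Longrightarrow> 0 \<le> radius A"
  unfolding approx_def using norm_ge_zero order_trans by blast

lemma approx_add:
  assumes "approx z A" "approx w B"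
  shows "approx (z + w) (A + B)"
proof -
  have "cmod (z + w - center (A + B)) \<le> cmod (z - center A) + cmod (w - center B)"
    using norm_triangle_ineq[of "z - center A" "w - center B"] by (simp add: algebra_simps)
  then show ?thesis
    using assms approx_radius_nonneg[OF assms(1)] approx_radius_nonneg[OF assms(2)]
    unfolding approx_def by fastforce
qed

lemma approx_diff:
  assumes "approx z A" "approx w B"
  shows "approx (z - w) (A - B)"
proof -
  have "cmod (z - w - center (A - B)) \<le> cmod (z - center A) + cmod (w - center B)"
    using norm_triangle_ineq4[of "z - center A" "w - center B"] by (simp add: algebra_simps)
  then show ?thesis
    using assms approx_radius_nonneg[OF assms(1)] approx_radius_nonneg[OF assms(2)]
    unfolding approx_def by fastforce
qed

lemma approx_mult:
  assumes A: "approx z A" and B: "approx w B"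
  shows "approx (z * w) (A * B)"
proof -
  define a b x y where "a = cmod (center A)" and "b = cmod (center B)"
    and "x = cmod (z - center A)" and "y = cmod (w - center B)"
  note nonneg = approx_radius_nonneg[OF A] approx_radius_nonneg[OF B]
  have xy: "x \<le> radius A" "radius A \<noteq> 0 \<Longrightarrow> x < radius A"
    "y \<le> radius B" "radius B \<noteq> 0 \<Longrightarrow> y < radius B"
    using A B by (auto simp: approx_def x_def y_def)
  have pos: "0 \<le> a" "0 \<le> b" "0 \<le> x" "0 \<le> y"
    by (simp_all add: a_def b_def x_def y_def)
  have "z * w - center A * center B = center A * (w - center B)
          + center B * (z - center A) + (z - center A) * (w - center B)"
    by (simp add: algebra_simps)
  then have le: "cmod (z * w - center (A * B)) \<le> a * y + b * x + x * y"
    unfolding a_def b_def x_def y_def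
    by (simp only: disk_times_simps norm_mult [symmetric])
      (intro order_trans[OF norm_triangle_ineq] add_right_mono norm_triangle_ineq)
  have le2: "a * y \<le> a * radius B" "b * x \<le> b * radius A" "x * y \<le> radius A * radius B"
    using xy nonneg pos by (auto intro!: mult_mono)
  have r: "radius (A * B) = a * radius B + b * radius A + radius A * radius B"
    by (simp add: a_def b_def)
  show ?thesis
  proof (cases "radius (A * B) = 0")
    case True
    then have "cmod (z * w - center (A * B)) \<le> 0" using le le2 r by linarith
    then show ?thesis using True by (simp add: approx_def)
  next
    case False
    \<comment> \<open>A nonzero radius has a nonzero summand among the three, and the corresponding
      term of the error is then strictly smaller.\<close>
    consider "radius A \<noteq> 0" "radius B \<noteq> 0" | "b \<noteq> 0" "radius A \<noteq> 0" | "a \<noteq> 0" "radius B \<noteq> 0"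
      using False r by fastforce
    then have "a * y + b * x + x * y < radius (A * B)"
    proof cases
      case 1
      then have "x * y < radius A * radius B"
        using xy pos by (intro mult_strict_mono') auto
      then show ?thesis using le2 r by linarith
    next
      case 2
      then have "b * x < b * radius A"
        using xy pos by (intro mult_strict_left_mono) auto
      then show ?thesis using le2 r by linarith
    next
      case 3
      then have "a * y < a * radius B"
        using xy pos by (intro mult_strict_left_mono) auto
      then show ?thesis using le2 r by linarith
    qed
    then show ?thesis using le by (simp add: approx_def)
  qed
qed

lemma approx_sum: "(\<And>k. k \<in> S \<Longrightarrow> approx (f k) (F k)) \<Longrightarrow> approx (sum f S) (sum F S)"
  by (induction S rule: infinite_finite_induct) (auto intro: approx_add)

lemma approx_prod: "(\<And>k. k \<in> S \<Longrightarrow> approx (f k) (F k)) \<Longrightarrow> approx (prod f S) (prod F S)"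
  by (induction S rule: infinite_finite_induct) (auto intro: approx_mult)

lemma norm_diff_sq: "(cmod (u - v))\<^sup>2 = (cmod u)\<^sup>2 + (cmod v)\<^sup>2 - 2 * Re (u * cnj v)"
  unfolding cmod_power2 by (simp add: power2_eq_square algebra_simps)

text \<open>The distance from 1/z to the computed center is |d - cnj b z| / (d |z|), to be compared
  with \<rho>/d. The squares of \<rho> |z| and |d - cnj b z| differ by d (\<rho>^2 - |z - b|^2), so
  membership of z carries over, together with its strictness.\<close>

lemma approx_recip:
  assumes A: "approx z A" and lt: "radius A < cmod (center A)"
  shows "approx (1 / z) (recip A)"
proof -
  define b \<rho> d where "b = center A" and "\<rho> = radius A" and "d = (cmod b)\<^sup>2 - \<rho>\<^sup>2"
  have \<rho>: "0 \<le> \<rho>" "\<rho> < cmod b"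
    using approx_radius_nonneg[OF A] lt by (auto simp: b_def \<rho>_def)
  then have d: "0 < d"
    using power_strict_mono[OF \<rho>(2,1), of 2] by (simp add: d_def)
  have z: "cmod (z - b) \<le> \<rho>" "\<rho> \<noteq> 0 \<Longrightarrow> cmod (z - b) < \<rho>"
    using A by (auto simp: approx_def b_def \<rho>_def)
  have "z \<noteq> 0"
  proof
    assume "z = 0"
    then show False using z(1) \<rho>(2) by simp
  qed
  have sq: "(cmod (of_real d - cnj b * z))\<^sup>2 = (\<rho> * cmod z)\<^sup>2 - d * (\<rho>\<^sup>2 - (cmod (z - b))\<^sup>2)"
  proof -
    have e1: "(cmod (of_real d - cnj b * z))\<^sup>2
        = d\<^sup>2 + (cmod b)\<^sup>2 * (cmod z)\<^sup>2 - 2 * d * Re (z * cnj b)"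
      unfolding norm_diff_sq by (simp add: norm_mult power_mult_distrib algebra_simps)
    have e2: "(cmod (z - b))\<^sup>2 = (cmod z)\<^sup>2 + (cmod b)\<^sup>2 - 2 * Re (z * cnj b)"
      unfolding norm_diff_sq by simp
    \<comment> \<open>With \<open>B\<close>, \<open>s\<close>, \<open>Z\<close>, \<open>Y\<close>
      for |b|^2, \<rho>^2, |z|^2 and Re (z cnj b), the claim is a polynomial identity.\<close>
    have *: "(B - s)\<^sup>2 + B * Z - 2 * (B - s) * Y = s * Z - (B - s) * (s - (Z + B - 2 * Y))"
      for B s Z Y :: real
      by (simp add: power2_eq_square algebra_simps)
    show ?thesis
      unfolding e1 e2 power_mult_distrib unfolding d_def by (rule *)
  qed
  have "1 / z - cnj b / of_real d = (of_real d - cnj b * z) / (of_real d * z)"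
    using d \<open>z \<noteq> 0\<close> by (simp add: field_simps)
  then have dist: "cmod (1 / z - cnj b / of_real d) = cmod (of_real d - cnj b * z) / (d * cmod z)"
    using d by (simp add: norm_divide norm_mult)
  have "(cmod (z - b))\<^sup>2 \<le> \<rho>\<^sup>2"
    using z by (simp add: power_mono)
  then have "(cmod (of_real d - cnj b * z))\<^sup>2 \<le> (\<rho> * cmod z)\<^sup>2"
    unfolding sq using d by simp
  then have le: "cmod (of_real d - cnj b * z) \<le> \<rho> * cmod z"
    by (rule power2_le_imp_le) (use \<rho> in simp)
  have lt: "cmod (of_real d - cnj b * z) < \<rho> * cmod z" if "\<rho> \<noteq> 0"
  proof -
    have "(cmod (z - b))\<^sup>2 < \<rho>\<^sup>2"
      using z that by (simp add: power_strict_mono)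
    then have "(cmod (of_real d - cnj b * z))\<^sup>2 < (\<rho> * cmod z)\<^sup>2"
      unfolding sq using d by simp
    then show ?thesis
      by (rule power2_less_imp_less) (use \<rho> in simp)
  qed
  have "cmod (1 / z - cnj b / of_real d) \<le> \<rho> / d"
    "\<rho> \<noteq> 0 \<Longrightarrow> cmod (1 / z - cnj b / of_real d) < \<rho> / d"
    unfolding dist using le lt d \<open>z \<noteq> 0\<close> by (simp_all add: field_simps)
  then show ?thesis
    using recip_simps[OF assms(2)] d by (simp add: approx_def b_def \<rho>_def d_def)
qed

text \<open>Since \<open>\<bar>center\<bar> + radius\<close> is multiplicative, the factors \<open>x\<close> simply multiply along products.\<close>

definition dbound :: "disk \<Rightarrow> real \<Rightarrow> real \<Rightarrow> bool" where
  "dbound A a x \<longleftrightarrow> 1 \<le> x \<and> 0 \<le> radius A \<and> cmod (center A) + radius A \<le> a * x \<and> radius A \<le> a * (x - 1)"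

lemma dbound_nonneg: assumes "dbound A a x" shows "0 \<le> a"
proof -
  have "0 \<le> a * x" "1 \<le> x"
    using assms norm_ge_zero[of "center A"] unfolding dbound_def by linarith+
  then show ?thesis
    by (auto simp: zero_le_mult_iff)
qed

lemma dbound_mono:
  assumes A: "dbound A a x" and a: "a \<le> a'" and x: "x \<le> x'"
  shows "dbound A a' x'"
proof -
  have "a * x \<le> a * x'" "a * (x - 1) \<le> a * (x' - 1)"
    using dbound_nonneg[OF A] x by (auto intro: mult_left_mono)
  moreover have "1 \<le> x'"
    using A x by (simp add: dbound_def)
  moreover from this have "a * x' \<le> a' * x'" "a * (x' - 1) \<le> a' * (x' - 1)"
    using a x by (auto intro: mult_right_mono)
  ultimately show ?thesis
    using A x unfolding dbound_def by linarith
qed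

lemma dbound_zero: "1 \<le> x \<Longrightarrow> dbound 0 0 x"
  by (simp add: dbound_def)

lemma dbound_one: "1 \<le> x \<Longrightarrow> dbound 1 1 x"
  by (simp add: dbound_def)

lemma dbound_add:
  assumes "dbound A a x" "dbound B b x"
  shows "dbound (A + B) (a + b) x"
  using assms norm_triangle_ineq[of "center A" "center B"]
  unfolding dbound_def distrib_right by auto

lemma dbound_diff:
  assumes "dbound A a x" "dbound B b x"
  shows "dbound (A - B) (a + b) x"
  using assms norm_triangle_ineq4[of "center A" "center B"]
  unfolding dbound_def distrib_right by auto

lemma dbound_mult:
  assumes A: "dbound A a x" and B: "dbound B b y"
  shows "dbound (A * B) (a * b) (x * y)"
proof -
  define u v \<rho> \<sigma> where "u = cmod (center A) + radius A" and "v = cmod (center B) + radius B"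
    and "\<rho> = radius A" and "\<sigma> = radius B"
  have *: "0 \<le> \<rho>" "\<rho> \<le> u" "u \<le> a * x" "\<rho> \<le> a * (x - 1)"
    "0 \<le> \<sigma>" "\<sigma> \<le> v" "v \<le> b * y" "\<sigma> \<le> b * (y - 1)"
    using A B by (simp_all add: dbound_def u_def v_def \<rho>_def \<sigma>_def)
  have eq: "cmod (center (A * B)) + radius (A * B) = u * v"
    "radius (A * B) = (u - \<rho>) * \<sigma> + v * \<rho>"
    by (simp_all add: u_def v_def \<rho>_def \<sigma>_def norm_mult algebra_simps)
  have "u * v \<le> (a * x) * (b * y)"
    using * by (intro mult_mono) auto
  moreover have "(u - \<rho>) * \<sigma> + v * \<rho> \<le> a * b * (x * y - 1)"
  proof -
    \<comment> \<open>Here \<open>\<rho>\<close> also occurs with a negative sign, so its own bound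
      is inserted last, once its terms have collected to \<open>b * \<rho>\<close>.\<close>
    have "(u - \<rho>) * \<sigma> + v * \<rho> \<le> (a * x - \<rho>) * \<sigma> + (b * y) * \<rho>"
      using * by (intro add_mono mult_right_mono) auto
    also have "\<dots> \<le> (a * x - \<rho>) * (b * (y - 1)) + (b * y) * \<rho>"
      using * by (intro add_mono mult_left_mono) auto
    also have "\<dots> = a * x * (b * (y - 1)) + b * \<rho>"
      by (simp add: algebra_simps)
    also have "\<dots> \<le> a * x * (b * (y - 1)) + b * (a * (x - 1))"
      using * dbound_nonneg[OF B] by (intro add_mono mult_left_mono) auto
    finally show ?thesis by (simp add: algebra_simps)
  qed
  moreover have "0 \<le> radius (A * B)"
    unfolding eq using * by (intro add_nonneg_nonneg mult_nonneg_nonneg) auto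
  moreover have "1 \<le> x * y"
    using A B mult_mono[of 1 x 1 y] by (simp add: dbound_def)
  ultimately show ?thesis
    unfolding dbound_def eq(1) unfolding eq(2) by (simp add: mult_ac)
qed

lemma dbound_sum: "(\<And>k. k \<in> S \<Longrightarrow> dbound (F k) (f k) x) \<Longrightarrow> 1 \<le> x \<Longrightarrow> dbound (sum F S) (sum f S) x"
  by (induction S rule: infinite_finite_induct) (auto intro: dbound_add dbound_zero)

lemma dbound_prod:
  assumes "\<And>k. k \<in> S \<Longrightarrow> dbound (F k) a x" "1 \<le> x"
  shows "dbound (prod F S) (a ^ card S) (x ^ card S)"
  using assms by (induction S rule: infinite_finite_induct) (auto intro: dbound_mult dbound_one)

lemma dbound_disk:
  assumes "1 \<le> x" "0 \<le> radius A" "cmod (center A) \<le> a" "radius A \<le> a * (x - 1)"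
  shows "dbound A a x"
  using assms by (auto simp: dbound_def algebra_simps)

text \<open>\<open>\<eta>\<close> bounds the radius relative to \<open>\<beta>\<close>. For center
  modulus b and radius \<rho>, the reciprocal has |center| + radius = 1/(b - \<rho>), and its radius
  is \<rho>/(b + \<rho>) \<le> \<eta> times that. The form a (x - 1) appears because \<eta>/(1 -
  \<eta>) = 1/(1 - \<eta>) - 1.\<close>

lemma dbound_recip:
  assumes "0 \<le> radius A" "radius A \<le> \<beta> * \<eta>" "\<beta> \<le> cmod (center A)" "0 < \<beta>" "\<eta> < 1"
  shows "dbound (recip A) (1 / \<beta>) (1 / (1 - \<eta>))" and "radius A < cmod (center A)"
proof -
  define b \<rho> where "b = cmod (center A)" and "\<rho> = radius A"
  have lt: "\<rho> < \<beta>"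
    using assms mult_strict_left_mono[of \<eta> 1 \<beta>] unfolding \<rho>_def by linarith
  then show "radius A < cmod (center A)"
    using assms by (simp add: \<rho>_def)
  note r = recip_simps[OF this, folded b_def \<rho>_def]
  have b: "0 \<le> \<rho>" "\<beta> \<le> b" "\<rho> < b" "\<rho> \<le> \<beta> * \<eta>"
    using assms lt by (auto simp: b_def \<rho>_def)
  have d: "b\<^sup>2 - \<rho>\<^sup>2 = (b - \<rho>) * (b + \<rho>)" "0 < (b - \<rho>) * (b + \<rho>)"
    using b by (simp add: power2_eq_square algebra_simps, intro mult_pos_pos) auto
  have c: "cmod (center (recip A)) = b / (b\<^sup>2 - \<rho>\<^sup>2)"
    unfolding r norm_divide norm_of_real using d by (simp add: b_def)
  have "cmod (center (recip A)) + radius (recip A) = 1 / (b - \<rho>)"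
  proof -
    have "cmod (center (recip A)) + radius (recip A) = (b + \<rho>) / ((b - \<rho>) * (b + \<rho>))"
      unfolding c r(2) d(1) by (simp add: add_divide_distrib)
    then show ?thesis using b by simp
  qed
  also have "\<dots> \<le> 1 / (\<beta> - \<beta> * \<eta>)"
    using b assms by (intro divide_left_mono mult_pos_pos) auto
  finally have 1: "cmod (center (recip A)) + radius (recip A) \<le> 1 / \<beta> * (1 / (1 - \<eta>))"
    by (simp add: algebra_simps)
  have "0 \<le> \<eta>"
    using order_trans[OF b(1,4)] \<open>0 < \<beta>\<close> by (simp add: zero_le_mult_iff)
  have "radius (recip A) = \<rho> / (b + \<rho>) * (1 / (b - \<rho>))"
    unfolding r d by simp
  also have "\<dots> \<le> \<eta> * (1 / (\<beta> - \<beta> * \<eta>))"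
  proof (intro mult_mono)
    have "\<rho> \<le> b * \<eta>" using b \<open>0 \<le> \<eta>\<close> by (meson mult_right_mono order_trans)
    also have "\<dots> \<le> (b + \<rho>) * \<eta>" using b \<open>0 \<le> \<eta>\<close> by (simp add: mult_right_mono)
    finally show "\<rho> / (b + \<rho>) \<le> \<eta>" using b assms by (simp add: field_simps)
    show "1 / (b - \<rho>) \<le> 1 / (\<beta> - \<beta> * \<eta>)"
      using b assms by (intro divide_left_mono mult_pos_pos) auto
  qed (use b \<open>0 \<le> \<eta>\<close> in auto)
  also have "\<dots> = 1 / \<beta> * (1 / (1 - \<eta>) - 1)"
    using assms by (simp add: field_simps)
  finally have 2: "radius (recip A) \<le> 1 / \<beta> * (1 / (1 - \<eta>) - 1)" .
  have "0 \<le> radius (recip A)"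
    unfolding r using b d by simp
  moreover have "1 \<le> 1 / (1 - \<eta>)"
    using \<open>0 \<le> \<eta>\<close> \<open>\<eta> < 1\<close> by simp
  ultimately show "dbound (recip A) (1 / \<beta>) (1 / (1 - \<eta>))"
    using 1 2 by (simp add: dbound_def)
qed

section \<open>Multiplicities as the solution of a linear system\<close>

lemma fps_geometric_mult:
  fixes a :: "'a :: comm_ring_1"
  shows "(1 - fps_const a * fps_X) * Abs_fps (\<lambda>s. a ^ s) = 1"
proof (rule fps_ext)
  fix n
  show "fps_nth ((1 - fps_const a * fps_X) * Abs_fps (\<lambda>s. a ^ s)) n = fps_nth 1 n"
    by (cases n) (simp_all add: left_diff_distrib mult.assoc fps_mult_fps_X_commute)
qed

text \<open>A logarithmic derivative without division: the geometric series stands for 1/(1 - a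
  X).\<close>

lemma fps_deriv_prod_linear_power:
  fixes a :: "'b \<Rightarrow> 'a :: comm_ring_1"
  shows "fps_deriv (\<Prod>k\<in>S. (1 - fps_const (a k) * fps_X) ^ m k) =
    - ((\<Prod>k\<in>S. (1 - fps_const (a k) * fps_X) ^ m k) *
       (\<Sum>k\<in>S. of_nat (m k) * fps_const (a k) * Abs_fps (\<lambda>s. a k ^ s)))"
proof (induction S rule: infinite_finite_induct)
  case (insert x S)
  define f g where "f = 1 - fps_const (a x) * fps_X" and "g = Abs_fps (\<lambda>s. a x ^ s)"
  have fg: "f * g = 1"
    unfolding f_def g_def by (rule fps_geometric_mult)
  have df: "fps_deriv f = - fps_const (a x)"
    by (simp add: f_def)
  have "fps_deriv (f ^ m x) = - (f ^ m x * (of_nat (m x) * fps_const (a x) * g))"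
  proof (cases "m x")
    case (Suc l)
    have "f ^ Suc l * g = f ^ l * (f * g)"
      by (simp add: mult_ac)
    then have "f ^ Suc l * g = f ^ l"
      by (simp add: fg)
    then have "f ^ Suc l * (of_nat (Suc l) * fps_const (a x) * g)
        = of_nat (Suc l) * fps_const (a x) * f ^ l"
      by (metis mult.assoc mult.commute)
    moreover have "fps_deriv (f ^ Suc l) = - (of_nat (Suc l) * fps_const (a x) * f ^ l)"
      unfolding fps_deriv_power df
      by (simp add: fps_of_nat mult_ac del: fps_const_neg fps_const_mult of_nat_Suc)
    ultimately show ?thesis
      unfolding Suc by simp
  qed simp
  \<comment> \<open>Logarithmic derivatives add up along products; with abstract factors the
    induction step is a single instance.\<close>
  moreover have "fps_deriv (F * Q) = - (F * Q * (u + T))"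
    if "fps_deriv F = - (F * u)" "fps_deriv Q = - (Q * T)" for F Q u T :: "'a fps"
    by (simp add: that algebra_simps)
  ultimately show ?case
    unfolding prod.insert[OF insert(1,2)] sum.insert[OF insert(1,2)] f_def g_def
    using insert(3) by blast
qed simp_all

lemma reflect_poly_linear: "reflect_poly [:- z, 1 :: complex:] = [:1, - z:]"
  by (rule poly_eqI) (simp add: coeff_reflect_poly coeff_pCons split: nat.split)

lemma coeff_sum_monom_diff:
  assumes "i \<le> t"
  shows "coeff (\<Sum>i\<le>t. monom (c i) (t - i)) (t - i) = c i"
proof -
  have "coeff (\<Sum>i\<le>t. monom (c i) (t - i)) (t - i) = (\<Sum>j\<le>t. if j = i then c j else 0)"
    unfolding coeff_sum by (intro sum.cong) (use assms in auto)
  then show ?thesis using assms by simp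
qed

lemma degree_sum_monom_diff:
  assumes "c 0 = (1 :: 'a :: comm_ring_1)"
  shows "degree (\<Sum>i\<le>t. monom (c i) (t - i)) = t"
proof (rule antisym)
  show "degree (\<Sum>i\<le>t. monom (c i) (t - i)) \<le> t"
    by (rule degree_sum_le) (auto intro: order_trans[OF degree_monom_le])
  show "t \<le> degree (\<Sum>i\<le>t. monom (c i) (t - i))"
    using coeff_sum_monom_diff[of 0 t c] assms by (intro le_degree) simp
qed

text \<open>The reflected polynomial has the coefficients \<open>c i\<close> and splits into powers
  of 1 - z X, where the root 0 contributes the factor 1. The identity compares coefficients of X^l
  in its logarithmic derivative, multiplied through by the polynomial.\<close>

lemma newton_identity:
  fixes c :: "nat \<Rightarrow> complex" and t :: nat
  defines "P \<equiv> \<Sum>i\<le>t. monom (c i) (t - i)"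
  assumes c0: "c 0 = 1" and l: "l < t"
  shows "(\<Sum>j\<le>l. c j * (\<Sum>z | z \<noteq> 0 \<and> poly P z = 0. of_nat (order z P) * z ^ (Suc l - j)))
    = - (of_nat (Suc l) * c (Suc l))"
proof -
  define Z where "Z = {z. poly P z = 0}"
  have deg: "degree P = t"
    unfolding P_def using c0 by (rule degree_sum_monom_diff)
  have cf: "coeff (reflect_poly P) i = c i" if "i \<le> t" for i
    using that deg by (simp add: coeff_reflect_poly) (simp add: P_def coeff_sum_monom_diff)
  have lead: "lead_coeff P = 1"
    unfolding deg using coeff_sum_monom_diff[of 0 t c] c0 by (simp add: P_def)
  then have "P \<noteq> 0" by auto
  then have fin: "finite Z"
    unfolding Z_def by (rule poly_roots_finite)
  have "P = (\<Prod>z\<in>Z. [:- z, 1:] ^ order z P)"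
    using complex_poly_decompose[of P] lead by (simp add: Z_def)
  then have "reflect_poly P = reflect_poly (\<Prod>z\<in>Z. [:- z, 1:] ^ order z P)"
    by (rule arg_cong)
  also have "\<dots> = (\<Prod>z\<in>Z. [:1, - z:] ^ order z P)"
    by (simp add: reflect_poly_prod reflect_poly_power reflect_poly_linear)
  finally have R: "reflect_poly P = (\<Prod>z\<in>Z. [:1, - z:] ^ order z P)" .
  have L: "fps_of_poly [:1, - z:] = 1 - fps_const z * fps_X" for z :: complex
    by (simp add: fps_of_poly_linear' del: fps_const_neg flip: fps_const_neg)
  have q: "fps_of_poly (reflect_poly P) =
      (\<Prod>z\<in>Z. (1 - fps_const z * fps_X) ^ order z P)"
    unfolding R fps_of_poly_prod fps_of_poly_power L ..
  have nth: "fps_nth (of_nat k * fps_const z * G) s = of_nat k * z * fps_nth G s"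
    for k s and z :: complex and G
    unfolding fps_of_nat[symmetric] fps_const_mult by simp
  have "of_nat (Suc l) * c (Suc l) = fps_nth (fps_deriv (fps_of_poly (reflect_poly P))) l"
    using l by (simp add: cf)
  also have "\<dots> = - (\<Sum>j\<le>l. c j * (\<Sum>z\<in>Z. of_nat (order z P) * z * z ^ (l - j)))"
    unfolding q fps_deriv_prod_linear_power unfolding q[symmetric]
    using l by (simp add: fps_mult_nth[of "fps_of_poly _"] atLeast0AtMost fps_sum_nth cf nth)
  \<comment> \<open>The factor z raises the exponent to \<open>Suc l - j\<close> and also removes
    the summand of the root 0.\<close>
  also have "(\<Sum>j\<le>l. c j * (\<Sum>z\<in>Z. of_nat (order z P) * z * z ^ (l - j)))
     = (\<Sum>j\<le>l. c j * (\<Sum>z | z \<noteq> 0 \<and> poly P z = 0. of_nat (order z P) * z ^ (Suc l - j)))"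
  proof (rule sum.cong[OF refl], rule arg_cong2[of _ _ _ _ "(*)", OF refl])
    fix j assume "j \<in> {..l}"
    then have "Suc l - j = Suc (l - j)" by auto
    then show "(\<Sum>z\<in>Z. of_nat (order z P) * z * z ^ (l - j)) =
        (\<Sum>z | z \<noteq> 0 \<and> poly P z = 0. of_nat (order z P) * z ^ (Suc l - j))"
      by (intro sum.mono_neutral_cong_right) (use fin in \<open>auto simp: Z_def\<close>)
  qed
  finally show ?thesis by simp
qed

section \<open>The Newton basis and the inverse Vandermonde matrix\<close>

definition newton_poly :: "(nat \<Rightarrow> complex) \<Rightarrow> nat \<Rightarrow> complex poly" where
  "newton_poly r j = (\<Prod>k\<in>{1..j}. [:- r k, 1:])"

lemma newton_poly_0 [simp]: "newton_poly r 0 = 1"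
  by (simp add: newton_poly_def)

lemma newton_poly_Suc: "newton_poly r (Suc j) = [:- r (Suc j), 1:] * newton_poly r j"
  by (simp add: newton_poly_def)

lemma degree_newton_poly: "degree (newton_poly r j) = j"
  unfolding newton_poly_def by (subst degree_prod_sum_eq) auto

lemma lead_coeff_newton_poly: "coeff (newton_poly r j) j = 1"
  by (induction j) (simp_all add: newton_poly_Suc coeff_eq_0 degree_newton_poly)

lemma poly_newton_poly: "poly (newton_poly r j) x = (\<Prod>k\<in>{1..j}. x - r k)"
  by (simp add: newton_poly_def poly_prod)

lemma poly_eq_sum_lessThan:
  fixes p :: "complex poly"
  assumes "degree p < n"
  shows "poly p x = (\<Sum>k<n. coeff p k * x ^ k)"
  unfolding poly_altdef
  by (rule sum.mono_neutral_left) (use assms in \<open>auto simp: coeff_eq_0\<close>)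

definition W_exact :: "nat \<Rightarrow> (nat \<Rightarrow> complex) \<Rightarrow> nat \<Rightarrow> nat \<Rightarrow> complex" where
  "W_exact n r i j = (if i > j then 0 else \<Prod>k\<in>{j+1..n} - {i}. r i - r k)"

text \<open>The expansion of a Lagrange polynomial in the Newton basis; the sum telescopes because
  \<open>x - r i = (x - r k) - (r i - r k)\<close>.\<close>

lemma sum_W_newton_poly:
  assumes i: "1 \<le> i" and "i \<le> N" "N \<le> n"
  shows "(\<Sum>j<N. W_exact n r i (Suc j) * poly (newton_poly r j) x) =
    (\<Prod>k\<in>{N+1..n}. r i - r k) * (\<Prod>k\<in>{1..N} - {i}. x - r k)"
  using assms(2,3)
proof (induction N rule: dec_induct)
  \<comment> \<open>Row i of W vanishes left of the diagonal, so the induction starts at N = i,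
    where a single summand is left.\<close>
  case base
  obtain i' where i': "i = Suc i'" using i by (cases i) auto
  have "(\<Sum>j<i'. W_exact n r i (Suc j) * poly (newton_poly r j) x) = 0"
    by (intro sum.neutral) (auto simp: W_exact_def i')
  moreover have "{1..i} - {i} = {1..i'}" "{i+1..n} - {i} = {i+1..n}" using i' by auto
  ultimately show ?case
    by (simp add: i' W_exact_def poly_newton_poly)
next
  case (step N)
  have split: "{N+1..n} = insert (Suc N) {Suc N + 1..n}" using step by auto
  have ins: "{1..Suc N} - {i} = insert (Suc N) ({1..N} - {i})" using step by auto
  define a where "a = (\<Prod>k\<in>{Suc N + 1..n}. r i - r k)"
  define b where "b = (\<Prod>k\<in>{1..N} - {i}. x - r k)"
  have "{Suc N + 1..n} - {i} = {Suc N + 1..n}" using step by auto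
  then have W: "W_exact n r i (Suc N) = a"
    using step by (simp add: W_exact_def a_def)
  \<comment> \<open>Since i \<le> N, the node \<open>r i\<close> is a zero of this basis element.
    Splitting off its factor gives (r i - r (N+1)) + (x - r i) = x - r (N+1), the telescoping
    step.\<close>
  have p: "poly (newton_poly r N) x = (x - r i) * b"
    unfolding poly_newton_poly b_def by (rule prod.remove) (use step i in auto)
  have a: "(\<Prod>k\<in>{N+1..n}. r i - r k) = (r i - r (Suc N)) * a"
    unfolding a_def split by simp
  have b: "(\<Prod>k\<in>{1..Suc N} - {i}. x - r k) = (x - r (Suc N)) * b"
    unfolding b_def ins by simp
  have "(\<Sum>j<N. W_exact n r i (Suc j) * poly (newton_poly r j) x) = (r i - r (Suc N)) * a * b"
    using step.IH step.prems unfolding a b_def[symmetric] by simp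
  then show ?case
    unfolding sum.lessThan_Suc W p b a_def[symmetric] by (simp add: algebra_simps)
qed

definition Delta_exact :: "nat \<Rightarrow> (nat \<Rightarrow> complex) \<Rightarrow> nat \<Rightarrow> complex" where
  "Delta_exact n r i = (\<Prod>k\<in>{1..n} - {i}. 1 / (r i - r k))"

text \<open>For distinct nodes this is the coefficient of x^k in the i-th Lagrange polynomial,
  divided by \<open>r i\<close>. The index \<open>i\<close> counts from 1 like the nodes,
  \<open>k\<close> from 0 like the exponents.\<close>

definition V0_inv_exact :: "nat \<Rightarrow> (nat \<Rightarrow> complex) \<Rightarrow> nat \<Rightarrow> nat \<Rightarrow> complex" where
  "V0_inv_exact n r i k =
     1 / r i * (\<Sum>j<n. Delta_exact n r i * W_exact n r i (Suc j) * coeff (newton_poly r j) k)"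

text \<open>Summing against the powers of \<open>r l\<close> evaluates the Lagrange polynomial of
  node i at node l; the remaining factor r l / r i is 1 when i = l.\<close>

lemma V0_inv_exact_mult:
  assumes i: "i \<in> {1..n}" and l: "l \<in> {1..n}" and inj: "inj_on r {1..n}" and nz: "r i \<noteq> 0"
  shows "(\<Sum>k<n. V0_inv_exact n r i k * (r l ^ k * r l)) = (if i = l then 1 else 0)"
proof -
  have "(\<Sum>k<n. V0_inv_exact n r i k * (r l ^ k * r l)) =
      r l / r i * (\<Sum>k<n. \<Sum>j<n. Delta_exact n r i * W_exact n r i (Suc j)
        * (coeff (newton_poly r j) k * r l ^ k))"
    unfolding V0_inv_exact_def sum_distrib_left sum_distrib_right
    by (intro sum.cong refl) (simp add: mult_ac)
  also have "(\<Sum>k<n. \<Sum>j<n. Delta_exact n r i * W_exact n r i (Suc j)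
        * (coeff (newton_poly r j) k * r l ^ k)) =
      (\<Sum>j<n. Delta_exact n r i * W_exact n r i (Suc j) * poly (newton_poly r j) (r l))"
    by (subst sum.swap, intro sum.cong refl)
      (simp add: poly_eq_sum_lessThan[of _ n] degree_newton_poly sum_distrib_left)
  also have "\<dots> = Delta_exact n r i * (\<Sum>j<n. W_exact n r i (Suc j) * poly (newton_poly r j) (r l))"
    by (simp add: sum_distrib_left mult.assoc)
  also have "\<dots> = Delta_exact n r i * (\<Prod>k\<in>{1..n} - {i}. r l - r k)"
    using i by (subst sum_W_newton_poly) auto
  also have "\<dots> = (if i = l then 1 else 0)"
  proof (cases "i = l")
    case True
    have "r i - r k \<noteq> 0" if "k \<in> {1..n} - {i}" for k
      using that inj i by (auto dest: inj_onD)
    then show ?thesis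
      using True unfolding Delta_exact_def prod.distrib[symmetric] by (simp add: prod.neutral)
  next
    case False
    then have "(\<Prod>k\<in>{1..n} - {i}. r l - r k) = 0"
      using l by (intro prod_zero) auto
    then show ?thesis using False by simp
  qed
  finally show ?thesis using nz by auto
qed

section \<open>Exact inverses and the vector of multiplicities\<close>

lemma inv_mat_eq:
  assumes A: "A \<in> carrier_mat n n" and B: "B \<in> carrier_mat n n" and AB: "A * B = 1\<^sub>m n"
  shows "inv_mat A = B"
proof -
  have BA: "B * A = 1\<^sub>m n"
    using mat_mult_left_right_inverse[OF A B AB] .
  \<comment> \<open>\<open>the\<close> in \<open>inv_mat\<close> is meaningful only if
    \<open>mat_inverse\<close> returns \<open>Some\<close>, which it does on units of the matrix
    ring.\<close>
  have "A \<in> Units (ring_mat TYPE(complex) n undefined)"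
    unfolding Units_def ring_mat_def using A B AB BA by auto
  then obtain X where X: "mat_inverse A = Some X"
    using mat_inverse(1)[OF A, of undefined] by (cases "mat_inverse A") auto
  then have "A * X = 1\<^sub>m n" "X \<in> carrier_mat n n"
    using mat_inverse(2)[OF A X] by auto
  then have "X = B * A * X"
    using BA by simp
  also have "\<dots> = B * (A * X)"
    by (rule assoc_mult_mat) (use A B \<open>X \<in> carrier_mat n n\<close> in auto)
  also have "\<dots> = B"
    using B \<open>A * X = 1\<^sub>m n\<close> by simp
  finally show ?thesis by (simp add: inv_mat_def X)
qed

text \<open>C is a truncated lower triangular Toeplitz matrix. Such matrices multiply like power
  series, so the inverse series provides the entries of C^-1.\<close>

definition C_inv_coeff :: "(nat \<Rightarrow> int) \<Rightarrow> nat \<Rightarrow> complex" where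
  "C_inv_coeff c = fps_nth (inverse (Abs_fps (\<lambda>i. of_int (c i))))"

lemma C_inv_coeff_conv:
  assumes "c 0 = 1"
  shows "(\<Sum>i\<le>s. of_int (c i) * C_inv_coeff c (s - i)) = (if s = 0 then 1 else 0)"
proof -
  define f :: "complex fps" where "f = Abs_fps (\<lambda>i. of_int (c i))"
  have "f * inverse f = 1"
    by (rule inverse_mult_eq_1') (simp add: f_def assms)
  then have "fps_nth (f * inverse f) s = fps_nth 1 s" by simp
  then show ?thesis
    by (simp add: fps_mult_nth atLeast0AtMost f_def C_inv_coeff_def)
qed

lemma inv_mat_C_mat:
  assumes "c 0 = 1"
  shows "inv_mat (C_mat n c) = mat n n (\<lambda>(k, l). if l \<le> k then C_inv_coeff c (k - l) else 0)"
    (is "_ = ?H")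
    and "C_mat n c * mat n n (\<lambda>(k, l). if l \<le> k then C_inv_coeff c (k - l) else 0) = 1\<^sub>m n"
proof -
  show *: "C_mat n c * ?H = 1\<^sub>m n"
  proof (rule eq_matI)
    fix k l assume "k < dim_row (1\<^sub>m n :: complex mat)" "l < dim_col (1\<^sub>m n :: complex mat)"
    then have kl: "k < n" "l < n" by auto
    have "(C_mat n c * ?H) $$ (k, l) =
        (\<Sum>j<n. (if j \<le> k then of_int (c (k - j)) else 0)
          * (if l \<le> j then C_inv_coeff c (j - l) else 0))"
      using kl by (simp add: C_mat_def mat1_def scalar_prod_def atLeast0LessThan)
        (intro sum.cong refl, simp)
    also have "\<dots> = (\<Sum>j\<in>{l..k}. of_int (c (k - j)) * C_inv_coeff c (j - l))"
      by (rule sum.mono_neutral_cong_right) (use kl in auto)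
    also have "\<dots> = (if k = l then 1 else 0)"
    proof (cases "l \<le> k")
      case True
      have "(\<Sum>j\<in>{l..k}. of_int (c (k - j)) * C_inv_coeff c (j - l)) =
          (\<Sum>i\<le>k - l. of_int (c i) * C_inv_coeff c (k - l - i))"
        by (rule sum.reindex_bij_witness[of _ "\<lambda>i. k - i" "\<lambda>j. k - j"]) (use True in auto)
      then show ?thesis using C_inv_coeff_conv[of c "k - l", OF assms] True by auto
    qed auto
    finally show "(C_mat n c * ?H) $$ (k, l) = 1\<^sub>m n $$ (k, l)"
      using kl by simp
  qed (auto simp: C_mat_def mat1_def)
  show "inv_mat (C_mat n c) = ?H"
    by (rule inv_mat_eq[OF _ _ *]) (auto simp: C_mat_def mat1_def)
qed

lemma inv_mat_Lambda_mat:
  shows "inv_mat (Lambda_mat n) = mat_diag n (\<lambda>l. - of_nat (Suc l))" (is "_ = ?L")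
  and "Lambda_mat n * mat_diag n (\<lambda>l. - of_nat (Suc l)) = 1\<^sub>m n"
proof -
  show *: "Lambda_mat n * ?L = 1\<^sub>m n"
    unfolding Lambda_mat_def diag1_def mat_diag_diag
    by (auto simp: mat_diag_def one_mat_def simp del: of_nat_Suc)
  show "inv_mat (Lambda_mat n) = ?L"
    by (rule inv_mat_eq[OF _ _ *]) (auto simp: Lambda_mat_def diag1_def)
qed

lemma V0_mat_eq: "V0_mat n r = mat n n (\<lambda>(i, j). r (Suc j) ^ i * r (Suc j))"
  unfolding V0_mat_def V_mat_def mat1_def diag1_def
  by (subst mat_diag_mult_right[of _ n]) auto

text \<open>The first conclusion concerns the closed formula for the multiplicities. The second is
  the exact counterpart of the disk computation, summed in the same order, so that inclusion can be
  applied operation by operation. Both follow from A m = c and the explicit inverse B of A.\<close>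

lemma multiplicity_vector:
  fixes c :: "nat \<Rightarrow> int" and t :: nat
  defines "P \<equiv> (\<Sum>i\<le>t. monom (of_int (c i)) (t - i)) :: complex poly"
  assumes c0: "c 0 = 1" and n: "n \<le> t" and inj: "inj_on r {1..n}"
    and roots: "r ` {1..n} = {z. z \<noteq> 0 \<and> poly P z = 0}" and i: "i < n"
  shows "(inv_mat (Lambda_mat n * C_mat n c * V0_mat n r) *\<^sub>v c_vec n c) $ i
      = of_nat (order (r (Suc i)) P)" (is ?thesis1)
    and "(\<Sum>l<n. (\<Sum>k<n. V0_inv_exact n r (Suc i) k * inv_mat (C_mat n c) $$ (k, l))
         * (- of_nat (Suc l)) * of_int (c (Suc l)))
      = of_nat (order (r (Suc i)) P)" (is ?thesis2)
proof -
  let ?L = "mat_diag n (\<lambda>l. - of_nat (Suc l)) :: complex mat"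
  define H where "H = inv_mat (C_mat n c)"
  define X where "X = mat n n (\<lambda>(i, k). V0_inv_exact n r (Suc i) k)"
  define mv :: "complex vec" where "mv = vec n (\<lambda>j. of_nat (order (r (Suc j)) P))"
  have carrier [simp]: "Lambda_mat n \<in> carrier_mat n n" "C_mat n c \<in> carrier_mat n n"
    "V0_mat n r \<in> carrier_mat n n" "?L \<in> carrier_mat n n" "H \<in> carrier_mat n n"
    "X \<in> carrier_mat n n" "mv \<in> carrier_vec n" "c_vec n c \<in> carrier_vec n"
    using inv_mat_C_mat(1)[of c n, OF c0]
    by (auto simp: Lambda_mat_def diag1_def C_mat_def mat1_def V0_mat_eq H_def X_def mv_def
        c_vec_def vec1_def)
  have CH: "C_mat n c * H = 1\<^sub>m n"
    using inv_mat_C_mat[of c n, OF c0] by (simp add: H_def)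
  have XV: "X * V0_mat n r = 1\<^sub>m n"
  proof (rule eq_matI)
    fix a b assume "a < dim_row (1\<^sub>m n :: complex mat)" "b < dim_col (1\<^sub>m n :: complex mat)"
    then have ab: "a < n" "b < n" by auto
    have "r (Suc a) \<in> r ` {1..n}" using ab by auto
    then have "r (Suc a) \<noteq> 0" using roots by auto
    then show "(X * V0_mat n r) $$ (a, b) = 1\<^sub>m n $$ (a, b)"
      using V0_inv_exact_mult[of "Suc a" n "Suc b" r] ab inj
      by (simp add: X_def V0_mat_eq scalar_prod_def atLeast0LessThan)
  qed (auto simp: X_def V0_mat_eq)
  have VX: "V0_mat n r * X = 1\<^sub>m n"
    by (rule mat_mult_left_right_inverse[OF _ _ XV]) auto
  define A where "A = Lambda_mat n * C_mat n c * V0_mat n r"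
  define B where "B = X * H * ?L"
  have AB: "A * B = 1\<^sub>m n"
  proof -
    have "A * B = Lambda_mat n * (C_mat n c * (V0_mat n r * X) * H) * ?L"
      unfolding A_def B_def
      by (simp add: assoc_mult_mat[of _ n n _ n _ n] mult_carrier_mat[of _ n n _ n])
    also have "\<dots> = 1\<^sub>m n"
      unfolding VX right_mult_one_mat[OF carrier(2)]
        CH right_mult_one_mat[OF carrier(1)] by (rule inv_mat_Lambda_mat)
    finally show ?thesis .
  qed
  have cA [simp]: "A \<in> carrier_mat n n" and cB [simp]: "B \<in> carrier_mat n n"
    unfolding A_def B_def by (intro mult_carrier_mat[of _ n n _ n] carrier)+
  have BA: "B * A = 1\<^sub>m n"
    by (rule mat_mult_left_right_inverse[OF _ _ AB]) auto
  have Amv: "A *\<^sub>v mv = c_vec n c"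
  proof -
    have "V0_mat n r *\<^sub>v mv = vec n (\<lambda>j. \<Sum>z | z \<noteq> 0 \<and> poly P z = 0. of_nat (order z P) * z ^ Suc j)"
    proof (rule eq_vecI)
      fix j assume "j < dim_vec (vec n (\<lambda>j. \<Sum>z | z \<noteq> 0 \<and> poly P z = 0. of_nat (order z P) * z ^ Suc j))"
      then have j: "j < n" by simp
      have "(\<Sum>z | z \<noteq> 0 \<and> poly P z = 0. of_nat (order z P) * z ^ Suc j) =
          (\<Sum>k\<in>{1..n}. of_nat (order (r k) P) * r k ^ Suc j)"
        unfolding roots[symmetric] by (rule sum.reindex_cong[OF inj refl refl])
      also have "\<dots> = (\<Sum>k<n. of_nat (order (r (Suc k)) P) * r (Suc k) ^ Suc j)"
        by (rule sum.reindex_bij_witness[of _ Suc "\<lambda>k. k - 1"]) auto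
      finally show "(V0_mat n r *\<^sub>v mv) $ j =
          vec n (\<lambda>j. \<Sum>z | z \<noteq> 0 \<and> poly P z = 0. of_nat (order z P) * z ^ Suc j) $ j"
        using j by (simp add: V0_mat_eq mv_def scalar_prod_def atLeast0LessThan mult_ac)
    qed (simp add: V0_mat_eq)
    moreover have "C_mat n c *\<^sub>v vec n (\<lambda>j. \<Sum>z | z \<noteq> 0 \<and> poly P z = 0. of_nat (order z P) * z ^ Suc j)
        = vec n (\<lambda>l. - (of_nat (Suc l) * of_int (c (Suc l))))" (is "_ *\<^sub>v ?v = ?w")
    proof (rule eq_vecI)
      fix l assume "l < dim_vec ?w"
      then have l: "l < n" by simp
      have "(C_mat n c *\<^sub>v ?v) $ l = (\<Sum>j<n. (if j \<le> l then of_int (c (l - j)) else 0)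
          * (\<Sum>z | z \<noteq> 0 \<and> poly P z = 0. of_nat (order z P) * z ^ Suc j))"
        using l by (simp add: C_mat_def mat1_def scalar_prod_def atLeast0LessThan)
          (intro sum.cong refl, simp)
      also have "\<dots> = (\<Sum>j\<le>l. of_int (c j)
          * (\<Sum>z | z \<noteq> 0 \<and> poly P z = 0. of_nat (order z P) * z ^ (Suc l - j)))"
      proof -
        have "(\<Sum>j<n. (if j \<le> l then of_int (c (l - j)) else 0)
          * (\<Sum>z | z \<noteq> 0 \<and> poly P z = 0. of_nat (order z P) * z ^ Suc j))
          = (\<Sum>j\<le>l. of_int (c (l - j))
          * (\<Sum>z | z \<noteq> 0 \<and> poly P z = 0. of_nat (order z P) * z ^ Suc j))"
          by (rule sum.mono_neutral_cong_right) (use l in auto)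
        also have "\<dots> = (\<Sum>j\<le>l. of_int (c j)
          * (\<Sum>z | z \<noteq> 0 \<and> poly P z = 0. of_nat (order z P) * z ^ (Suc l - j)))"
          by (rule sum.reindex_bij_witness[of _ "\<lambda>j. l - j" "\<lambda>j. l - j"]) (auto simp: Suc_diff_le)
        finally show ?thesis .
      qed
      \<comment> \<open>\<open>n \<le> t\<close> keeps \<open>Suc l\<close> within the coefficients
        of the polynomial, as Newton's identity requires.\<close>
      also have "\<dots> = - (of_nat (Suc l) * of_int (c (Suc l)))"
        unfolding P_def by (rule newton_identity) (use c0 n l in auto)
      finally show "(C_mat n c *\<^sub>v ?v) $ l = ?w $ l" using l by simp
    qed (simp add: C_mat_def mat1_def)
    moreover have "Lambda_mat n *\<^sub>v vec n (\<lambda>l. - (of_nat (Suc l) * of_int (c (Suc l)))) = c_vec n c"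
    proof (rule eq_vecI)
      fix l assume "l < dim_vec (c_vec n c)"
      then have l: "l < n" by (simp add: c_vec_def vec1_def)
      have "(Lambda_mat n *\<^sub>v vec n (\<lambda>l. - (of_nat (Suc l) * of_int (c (Suc l))))) $ l =
          (\<Sum>j<n. (if l = j then - (1 / of_nat (Suc j)) else 0) * - (of_nat (Suc j) * of_int (c (Suc j))))"
        using l unfolding Lambda_mat_def diag1_def mat_diag_def
        by (simp add: scalar_prod_def atLeast0LessThan del: of_nat_Suc)
      also have "\<dots> = (\<Sum>j<n. if j = l then of_int (c (Suc l)) else 0)"
        by (intro sum.cong refl) (auto simp del: of_nat_Suc)
      also have "\<dots> = of_int (c (Suc l))"
        using l by (simp del: of_nat_Suc)
      finally show "(Lambda_mat n *\<^sub>v vec n (\<lambda>l. - (of_nat (Suc l) * of_int (c (Suc l))))) $ l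
          = c_vec n c $ l"
        using l by (simp add: c_vec_def vec1_def)
    qed (simp add: c_vec_def vec1_def Lambda_mat_def diag1_def mat_diag_def)
    ultimately have "Lambda_mat n *\<^sub>v (C_mat n c *\<^sub>v (V0_mat n r *\<^sub>v mv)) = c_vec n c"
      by (simp only:)
    moreover have "A *\<^sub>v mv = Lambda_mat n *\<^sub>v (C_mat n c *\<^sub>v (V0_mat n r *\<^sub>v mv))"
      unfolding A_def by (simp add: assoc_mult_mat_vec[of _ n n _ n]
          mult_carrier_mat[of _ n n _ n] mult_mat_vec_carrier[of _ n n])
    ultimately show ?thesis by simp
  qed
  have Bc: "B *\<^sub>v c_vec n c = mv"
    unfolding Amv[symmetric] using BA by (simp add: assoc_mult_mat_vec[of _ n n _ n, symmetric])
  have "inv_mat A = B"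
    by (rule inv_mat_eq[OF _ _ AB]) auto
  then show ?thesis1
    using Bc i by (simp add: A_def mv_def)
  have "X * H * ?L = mat n n (\<lambda>(a, l). (X * H) $$ (a, l) * (- of_nat (Suc l)))"
    by (subst mat_diag_mult_right[of _ n]) (auto intro: mult_carrier_mat[of _ n n _ n])
  then have "(B *\<^sub>v c_vec n c) $ i = (\<Sum>l<n. (X * H) $$ (i, l) * (- of_nat (Suc l)) * of_int (c (Suc l)))"
    unfolding B_def using i
    by (simp add: scalar_prod_def atLeast0LessThan c_vec_def vec1_def del: of_nat_Suc index_mult_mat)
  also have "\<dots> = (\<Sum>l<n. (\<Sum>k<n. V0_inv_exact n r (Suc i) k * H $$ (k, l))
         * (- of_nat (Suc l)) * of_int (c (Suc l)))"
  proof (intro sum.cong refl arg_cong2[of _ _ _ _ "(*)"])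
    fix l assume "l \<in> {..<n}"
    then show "(X * H) $$ (i, l) = (\<Sum>k<n. V0_inv_exact n r (Suc i) k * H $$ (k, l))"
      using i carrier_matD[OF carrier(5)]
      by (simp add: X_def scalar_prod_def atLeast0LessThan)
  qed
  finally show ?thesis2
    using Bc i by (simp add: mv_def H_def)
qed

section \<open>The smallest nonzero root of a monic integer polynomial\<close>

abbreviation (input) cpoly :: "int poly \<Rightarrow> complex poly" where
  "cpoly \<equiv> map_poly of_int"

lemma cpoly_add: "cpoly (p + q) = cpoly p + cpoly q"
  by (rule poly_eqI) (simp add: coeff_map_poly)

lemma cpoly_mult: "cpoly (p * q) = cpoly p * cpoly q"
  by (rule poly_eqI) (simp add: coeff_map_poly coeff_mult)

lemma cpoly_smult: "cpoly (smult a p) = smult (of_int a) (cpoly p)"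
  by (rule poly_eqI) (simp add: coeff_map_poly)

lemma cpoly_pderiv: "cpoly (pderiv p) = pderiv (cpoly p)"
  by (rule poly_eqI) (simp add: coeff_map_poly coeff_pderiv)

lemma degree_cpoly [simp]: "degree (cpoly p) = degree p"
  by (simp add: degree_map_poly)

lemma cpoly_eq_0_iff [simp]: "cpoly p = 0 \<longleftrightarrow> p = 0"
  by (metis coeff_0 coeff_map_poly of_int_eq_0_iff poly_eqI of_int_0)

text \<open>Pseudo-division by a nonzero integer polynomial of least degree that vanishes at \<open>\<beta>\<close>
  leaves no remainder; primality of \<open>f\<close> then does the work of a minimal polynomial over the
  rationals.\<close>

lemma irreducible_degree_le:
  fixes f g :: "int poly"
  assumes f: "irreducible f" "poly (cpoly f) \<beta> = 0"
    and g: "g \<noteq> 0" "poly (cpoly g) \<beta> = 0"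
  shows "degree f \<le> degree g"
proof -
  let ?P = "\<lambda>d. \<exists>g. g \<noteq> 0 \<and> poly (cpoly g) \<beta> = 0 \<and> degree g = d"
  define d where "d = (LEAST d. ?P d)"
  have "?P (degree g)" using g by blast
  then have "?P d" and le: "d \<le> degree g"
    unfolding d_def by (rule LeastI, rule Least_le)
  then obtain h where h: "h \<noteq> 0" "poly (cpoly h) \<beta> = 0" "degree h = d"
    by blast
  have least: "s = 0" if "poly (cpoly s) \<beta> = 0" "degree s < d" for s
    using that not_less_Least[of "degree s" ?P] unfolding d_def by blast
  obtain q s where qs: "pseudo_divmod f h = (q, s)"
    by fastforce
  define l where "l = lead_coeff h ^ (Suc (degree f) - degree h)"
  have eq: "smult l f = h * q + s" and s: "s = 0 \<or> degree s < degree h"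
    using pseudo_divmod[OF h(1) qs] by (auto simp: l_def)
  have "poly (cpoly (smult l f)) \<beta> = poly (cpoly (h * q + s)) \<beta>"
    by (simp only: eq)
  then have "poly (cpoly s) \<beta> = 0"
    by (simp add: cpoly_smult cpoly_add cpoly_mult f h)
  then have "s = 0"
    using s least h(3) by blast
  with eq have eq: "smult l f = h * q"
    by simp
  have "l \<noteq> 0"
    using h(1) by (simp add: l_def)
  have "prime_elem f"
    using f(1) by (simp add: irreducible_imp_prime_elem)
  moreover have "f dvd h * q"
    by (simp add: eq[symmetric] dvd_smult)
  ultimately consider "f dvd h" | "f dvd q"
    using prime_elem_dvd_multD by blast
  then show ?thesis
  proof cases
    case 1
    then show ?thesis
      using h le dvd_imp_degree_le[of f h] by simp
  next
    \<comment> \<open>Cancelling \<open>f\<close> makes \<open>h\<close> a divisor of the nonzero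
      constant \<open>l\<close>, hence a nonzero constant, which cannot vanish at
      \<open>\<beta>\<close>.\<close>
    case 2
    then obtain k where "q = f * k" by blast
    with eq have "f * (h * k) = f * [:l:]"
      by (simp add: mult_ac)
    moreover have "f \<noteq> 0" using f(1) by auto
    ultimately have "h * k = [:l:]"
      by (metis mult_left_cancel)
    moreover from this have "k \<noteq> 0"
      using \<open>l \<noteq> 0\<close> by auto
    ultimately have "degree h = 0"
      using degree_mult_eq[OF h(1), of k] by simp
    then obtain a where "h = [:a:]"
      by (rule degree_eq_zeroE)
    then show ?thesis using h by (simp add: map_poly_pCons)
  qed
qed

text \<open>A multiple root would be a root of the derivative, a nonzero integer polynomial of
  smaller degree than \<open>f\<close>.\<close>

lemma irreducible_int_order_root:
  assumes f: "irreducible (f :: int poly)" and z: "poly (cpoly f) z = 0"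
  shows "order z (cpoly f) = 1"
proof -
  have "f \<noteq> 0" using f by auto
  have "degree f \<noteq> 0"
  proof
    assume "degree f = 0"
    then obtain a where "f = [:a:]" by (rule degree_eq_zeroE)
    then show False using z \<open>f \<noteq> 0\<close> by (simp add: map_poly_pCons)
  qed
  have "poly (pderiv (cpoly f)) z \<noteq> 0"
  proof
    assume "poly (pderiv (cpoly f)) z = 0"
    moreover have "pderiv f \<noteq> 0" using \<open>degree f \<noteq> 0\<close> by (simp add: pderiv_eq_0_iff)
    ultimately have "degree f \<le> degree (pderiv f)"
      using irreducible_degree_le[OF f z] by (simp add: cpoly_pderiv)
    then show False using \<open>degree f \<noteq> 0\<close> by (simp add: degree_pderiv)
  qed
  have "pderiv (cpoly f) \<noteq> 0" using \<open>poly (pderiv (cpoly f)) z \<noteq> 0\<close> by auto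
  then have "order z (cpoly f) = Suc (order z (pderiv (cpoly f)))"
    using z \<open>f \<noteq> 0\<close> by (intro order_pderiv) (auto simp: order_root)
  moreover have "order z (pderiv (cpoly f)) = 0"
    using \<open>poly (pderiv (cpoly f)) z \<noteq> 0\<close> by (simp add: order_root)
  ultimately show ?thesis by simp
qed

text \<open>An irreducible factor f of p that vanishes at z has leading coefficient 1 or -1 and a
  nonzero integer as constant term. Its roots are simple, so |f(0)| \<ge> 1 is the product of their
  moduli, each taken once. Multiplicities would otherwise let the number of factors exceed the
  number of distinct roots.\<close>

lemma monic_int_root_subset_prod_ge_1:
  fixes p :: "int poly"
  assumes p: "lead_coeff p = 1" and z: "poly (cpoly p) z = 0" "z \<noteq> 0"
  obtains S where "finite S" "z \<in> S" "S \<subseteq> {w. w \<noteq> 0 \<and> poly (cpoly p) w = 0}"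
    "1 \<le> (\<Prod>w\<in>S. cmod w)"
proof -
  have "p \<noteq> 0" using p by auto
  then obtain A where A: "\<And>q. q \<in># A \<Longrightarrow> prime_elem q" "normalize (prod_mset A) = normalize p"
    using prime_factorization_exists[of p] by blast
  have "p dvd prod_mset A" using A(2) by (simp add: associated_iff_dvd)
  then have "poly (cpoly (prod_mset A)) z = 0"
    using z by (auto elim!: dvdE simp: cpoly_mult)
  moreover have "\<exists>f\<in>#B. poly (cpoly f) z = 0" if "poly (cpoly (prod_mset B)) z = 0" for B
    using that by (induction B) (auto simp: cpoly_mult)
  ultimately obtain f where f: "f \<in># A" "poly (cpoly f) z = 0"
    by blast
  have irr: "irreducible f" using A(1) f(1) prime_elem_imp_irreducible by blast
  have "f dvd p"
    using dvd_prod_mset[OF f(1)] A(2) dvd_trans by (auto simp: associated_iff_dvd)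
  then obtain g where g: "p = f * g" by blast
  then have "lead_coeff f * lead_coeff g = 1"
    using p by (simp add: lead_coeff_mult)
  then have lead: "\<bar>lead_coeff f\<bar> = 1"
    by (metis abs_one abs_zmult_eq_1)
  \<comment> \<open>Otherwise \<open>f\<close> is a unit times x, whose only root is 0, while
    \<open>z\<close> is a nonzero root.\<close>
  have f0: "poly f 0 \<noteq> 0"
  proof
    assume "poly f 0 = 0"
    then have "[:0, 1:] dvd f" by (simp add: poly_eq_0_iff_dvd)
    then obtain k where k: "f = [:0, 1:] * k" by blast
    moreover have "\<not> is_unit [:0, 1 :: int:]"
      by (simp add: is_unit_poly_iff)
    ultimately have "is_unit k"
      using irreducibleD[OF irr k] by blast
    then obtain u where "k = [:u:]" "u dvd 1"
      by (auto simp: is_unit_poly_iff)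
    then show False
      using f(2) z(2) k by (auto simp: map_poly_pCons)
  qed
  define S where "S = {w. poly (cpoly f) w = 0}"
  have "f \<noteq> 0" using irr by auto
  have "finite S" unfolding S_def by (rule poly_roots_finite) (use \<open>f \<noteq> 0\<close> in simp)
  have cf0: "poly (cpoly f) 0 = of_int (poly f 0)"
    by (simp add: poly_0_coeff_0 coeff_map_poly)
  have "cpoly f = smult (lead_coeff (cpoly f)) (\<Prod>w\<in>S. [:-w, 1:] ^ order w (cpoly f))"
    unfolding S_def by (rule complex_poly_decompose[symmetric])
  also have "(\<Prod>w\<in>S. [:-w, 1:] ^ order w (cpoly f)) = (\<Prod>w\<in>S. [:-w, 1:])"
    by (intro prod.cong) (use irreducible_int_order_root[OF irr] S_def in auto)
  finally have "poly (cpoly f) 0 = poly (smult (lead_coeff (cpoly f)) (\<Prod>w\<in>S. [:-w, 1:])) 0"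
    by (rule arg_cong)
  then have "cmod (of_int (poly f 0)) = cmod (of_int (lead_coeff f)) * (\<Prod>w\<in>S. cmod w)"
    unfolding cf0 by (simp add: poly_prod norm_mult coeff_map_poly flip: prod_norm)
  then have "real_of_int \<bar>poly f 0\<bar> = (\<Prod>w\<in>S. cmod w)"
    using lead by (metis mult_1 norm_of_int of_int_1 of_int_abs)
  then have "1 \<le> (\<Prod>w\<in>S. cmod w)"
    using f0 by linarith
  moreover have "S \<subseteq> {w. w \<noteq> 0 \<and> poly (cpoly p) w = 0}"
    using f0 cf0 by (auto simp: S_def g cpoly_mult)
  moreover have "z \<in> S" using f by (simp add: S_def)
  ultimately show ?thesis
    using that \<open>finite S\<close> by blast
qed

text \<open>Every factor except |z| is replaced by \<open>B\<close>. Since \<open>B\<close> is at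
  least 1, the exponent may grow from \<open>card S - 1\<close>, which is not known, to
  \<open>card Z - 1\<close>. The bound is left free because it is used with R and with M +
  1/n.\<close>

lemma norm_root_ge:
  fixes p :: "int poly" and B :: real
  defines "Z \<equiv> {w. w \<noteq> 0 \<and> poly (cpoly p) w = 0}"
  assumes p: "lead_coeff p = 1" and z: "z \<in> Z" and B: "1 \<le> B" "\<And>w. w \<in> Z \<Longrightarrow> cmod w \<le> B"
  shows "1 \<le> cmod z * B ^ (card Z - 1)"
proof -
  obtain S where S: "finite S" "z \<in> S" "S \<subseteq> Z" "1 \<le> (\<Prod>w\<in>S. cmod w)"
    using monic_int_root_subset_prod_ge_1[OF p, of z] z unfolding Z_def by blast
  have "p \<noteq> 0" using p by auto
  then have "finite {w. poly (cpoly p) w = 0}"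
    by (intro poly_roots_finite) simp
  then have "finite Z"
    by (rule rev_finite_subset) (auto simp: Z_def)
  have "1 \<le> cmod z * (\<Prod>w\<in>S - {z}. cmod w)"
    using S by (simp add: prod.remove)
  also have "\<dots> \<le> cmod z * (\<Prod>w\<in>S - {z}. B)"
    using S B by (intro mult_left_mono prod_mono) auto
  also have "\<dots> = cmod z * B ^ (card S - 1)"
    using S by simp
  also have "\<dots> \<le> cmod z * B ^ (card Z - 1)"
    using B S \<open>finite Z\<close> by (intro mult_left_mono power_increasing diff_le_mono card_mono) auto
  finally show ?thesis .
qed

text \<open>Bernoulli's inequality for the reciprocal base n/(n+1) = 1 - 1/(n+1) gives
  (n/(n+1))^(n-1) \<ge> 2/(n+1) \<ge> 1/n.\<close>

lemma one_plus_inverse_power_le: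
  assumes "n \<ge> 1"
  shows "(1 + 1 / real n) ^ (n - 1) \<le> n"
proof -
  define y where "y = 1 / (real n + 1)"
  have y: "0 \<le> 1 - y" "1 - y = real n / (real n + 1)"
    by (auto simp: y_def field_simps)
  have "1 + real (n - 1) * (- y) \<le> (1 + (- y)) ^ (n - 1)"
    by (intro Bernoulli_inequality) (simp add: y_def)
  moreover have "1 / real n \<le> 1 + real (n - 1) * (- y)"
    using assms by (simp add: y_def field_simps of_nat_diff)
  ultimately have "1 / real n \<le> (real n / (real n + 1)) ^ (n - 1)"
    using y by simp
  then have "((real n + 1) / real n) ^ (n - 1) \<le> n"
    using assms by (simp add: power_divide field_simps)
  then show ?thesis
    using assms by (simp add: add_divide_distrib)
qed

lemma inverse_norm_root_le:
  fixes p :: "int poly" and M R :: real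
  defines "Z \<equiv> {w. w \<noteq> 0 \<and> poly (cpoly p) w = 0}"
  assumes p: "lead_coeff p = 1" and z: "z \<in> Z"
    and R: "1 \<le> R" "\<And>w. w \<in> Z \<Longrightarrow> cmod w \<le> R"
    and M: "1 \<le> M" "\<And>w. w \<in> Z \<Longrightarrow> cmod (w - z) \<le> M"
  shows "1 \<le> min (cmod z) 1 * (card Z * min M R ^ (card Z - 1))"
proof -
  define n where "n = card Z"
  have "p \<noteq> 0" using p by auto
  then have "finite {w. poly (cpoly p) w = 0}"
    by (intro poly_roots_finite) simp
  then have "finite Z"
    by (rule rev_finite_subset) (auto simp: Z_def)
  then have n: "1 \<le> n"
    using z by (metis One_nat_def Suc_leI card_gt_0_iff empty_iff n_def)
  have pow: "1 \<le> min M R ^ (n - 1)"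
    using R M by (intro one_le_power) auto
  have 1: "1 \<le> cmod z * (n * R ^ (n - 1))"
  proof -
    have "1 \<le> cmod z * R ^ (n - 1)"
      using norm_root_ge[OF p _ R(1), of z] z R(2) unfolding Z_def n_def by blast
    also have "\<dots> \<le> cmod z * (n * R ^ (n - 1))"
      using n R by (intro mult_left_mono) (auto simp: mult_le_cancel_right1)
    finally show ?thesis .
  qed
  \<comment> \<open>The threshold 1/n balances two losses of a factor n: above it 1 \<le> n |z| is
    immediate, below it passing from M to M + 1/n costs (1 + 1/n)^(n-1).\<close>
  have 2: "1 \<le> cmod z * (n * M ^ (n - 1))"
  proof (cases "cmod z \<le> 1 / n")
    case True
    have "cmod w \<le> M + 1 / n" if "w \<in> Z" for w
      using M(2)[OF that] True norm_triangle_sub[of w z] by linarith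
    moreover have "1 \<le> M + 1 / n" using M(1) by (simp add: add_increasing2)
    ultimately have "1 \<le> cmod z * (M + 1 / n) ^ (n - 1)"
      using norm_root_ge[OF p, of z "M + 1 / n"] z unfolding Z_def n_def by blast
    also have "\<dots> \<le> cmod z * (M * (1 + 1 / n)) ^ (n - 1)"
      using M n by (intro mult_left_mono power_mono) (auto simp: field_simps)
    also have "\<dots> \<le> cmod z * (M ^ (n - 1) * n)"
      unfolding power_mult_distrib
      using M one_plus_inverse_power_le[OF n] by (intro mult_left_mono) auto
    finally show ?thesis by (simp add: mult_ac)
  next
    case False
    then have "1 \<le> cmod z * n" using n by (simp add: field_simps)
    also have "\<dots> \<le> cmod z * n * M ^ (n - 1)"
      using M(1) mult_left_mono[of 1 "M ^ (n - 1)" "cmod z * n"] by (simp add: one_le_power)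
    finally show ?thesis by (simp add: mult_ac)
  qed
  have "1 \<le> cmod z * (n * min M R ^ (n - 1))"
    using 1 2 by (simp add: min_def)
  moreover have "1 \<le> 1 * (n * min M R ^ (n - 1))"
    using n pow mult_mono[of 1 "real n" 1 "min M R ^ (n - 1)"] by simp
  ultimately show ?thesis
    unfolding n_def by (simp add: min_def)
qed

section \<open>Radii of the computed disks\<close>

lemma diag_disk_mat_mult:
  assumes "A \<in> carrier_mat n n"
  shows "mat_diag n f **\<^sub>D A = mat n n (\<lambda>(i, j). f i * A $$ (i, j))"
proof (rule eq_matI)
  fix i j assume "i < dim_row (mat n n (\<lambda>(i, j). f i * A $$ (i, j)))"
    "j < dim_col (mat n n (\<lambda>(i, j). f i * A $$ (i, j)))"
  then have ij: "i < n" "j < n" by auto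
  have "(mat_diag n f **\<^sub>D A) $$ (i, j) = (\<Sum>k<n. (if i = k then f k else 0) * A $$ (k, j))"
    using ij assms by (simp add: disk_mat_mult_def mat_diag_def)
  also have "\<dots> = (\<Sum>k<n. if k = i then f i * A $$ (i, j) else 0)"
    by (intro sum.cong) auto
  finally show "(mat_diag n f **\<^sub>D A) $$ (i, j) = mat n n (\<lambda>(i, j). f i * A $$ (i, j)) $$ (i, j)"
    using ij by simp
qed (use assms in \<open>auto simp: disk_mat_mult_def mat_diag_def\<close>)

lemma disk_mat_mult_diag:
  assumes "A \<in> carrier_mat n n"
  shows "A **\<^sub>D mat_diag n f = mat n n (\<lambda>(i, j). A $$ (i, j) * f j)"
proof (rule eq_matI)
  fix i j assume "i < dim_row (mat n n (\<lambda>(i, j). A $$ (i, j) * f j))"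
    "j < dim_col (mat n n (\<lambda>(i, j). A $$ (i, j) * f j))"
  then have ij: "i < n" "j < n" by auto
  have "(A **\<^sub>D mat_diag n f) $$ (i, j) = (\<Sum>k<n. A $$ (i, k) * (if k = j then f j else 0))"
    using ij assms by (simp add: disk_mat_mult_def mat_diag_def)
  also have "\<dots> = (\<Sum>k<n. if k = j then A $$ (i, j) * f j else 0)"
    by (intro sum.cong) auto
  finally show "(A **\<^sub>D mat_diag n f) $$ (i, j) = mat n n (\<lambda>(i, j). A $$ (i, j) * f j) $$ (i, j)"
    using ij by simp
qed (use assms in \<open>auto simp: disk_mat_mult_def mat_diag_def\<close>)

text \<open>The reciprocal stays outside the sum, as in the computation, because disk multiplication
  does not distribute over addition. Indices follow \<open>V0_inv_exact\<close>.\<close>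

definition V0_inv_entry :: "nat \<Rightarrow> (nat \<Rightarrow> disk) \<Rightarrow> nat \<Rightarrow> nat \<Rightarrow> disk" where
  "V0_inv_entry n D i k = recip (D i) *
     (\<Sum>j<n. Delta_disk n D i * W_disk n D i (Suc j) * L_disk D (Suc j) (Suc k))"

lemma V0_inv_disk_eq:
  "V0_inv_disk n D = mat n n (\<lambda>(i, k). V0_inv_entry n D (Suc i) k)"
proof -
  have "V_inv_disk n D = mat n n (\<lambda>(i, k). \<Sum>j<n. Delta_disk n D (Suc i) * W_disk n D (Suc i) (Suc j)
      * L_disk D (Suc j) (Suc k))"
    unfolding V_inv_disk_def diag1_def mat1_def
    by (subst diag_disk_mat_mult) (auto simp: disk_mat_mult_def intro!: eq_matI)
  then show ?thesis
    unfolding V0_inv_disk_def diag1_def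
    by (subst diag_disk_mat_mult) (auto simp: V0_inv_entry_def intro!: eq_matI)
qed

lemma multiplicity_disks_nth:
  assumes c0: "c 0 = 1" and i: "i < n"
  shows "multiplicity_disks n c D $ i =
    (\<Sum>l<n. (\<Sum>k<n. V0_inv_entry n D (Suc i) k * exact (inv_mat (C_mat n c) $$ (k, l)))
       * exact (- of_nat (Suc l)) * exact (of_int (c (Suc l))))"
proof -
  define H where "H = inv_mat (C_mat n c)"
  have H: "H \<in> carrier_mat n n"
    using inv_mat_C_mat(1)[of c n, OF c0] by (simp add: H_def)
  have L: "map_mat exact (inv_mat (Lambda_mat n)) = mat_diag n (\<lambda>l. exact (- of_nat (Suc l)))"
    unfolding inv_mat_Lambda_mat mat_diag_def zero_disk_def by (auto intro!: eq_matI)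
  define F where "F = V0_inv_disk n D **\<^sub>D map_mat exact H"
  have F: "F = mat n n (\<lambda>(i, l). \<Sum>k<n. V0_inv_entry n D (Suc i) k * exact (H $$ (k, l)))"
    unfolding F_def V0_inv_disk_eq disk_mat_mult_def using H by (auto intro!: eq_matI sum.cong)
  have "F **\<^sub>D mat_diag n (\<lambda>l. exact (- of_nat (Suc l))) =
      mat n n (\<lambda>(i, l). F $$ (i, l) * exact (- of_nat (Suc l)))"
    by (rule disk_mat_mult_diag) (simp add: F)
  then show ?thesis
    unfolding multiplicity_disks_def L H_def[symmetric] F_def[symmetric]
    using i by (simp add: disk_mat_vec_def c_vec_def vec1_def F del: of_nat_Suc)
qed

text \<open>The recurrence of L is multiplication of a Newton polynomial by x - r (i+1), read off
  coefficientwise; column 0 of L plays the coefficient of index -1.\<close>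

lemma approx_L_disk:
  assumes D: "\<And>k. approx (r k) (D k)"
  shows "approx (coeff (newton_poly r i) j) (L_disk D (Suc i) (Suc j))"
proof (induction i arbitrary: j)
  case (Suc i)
  consider "Suc i < j" | "Suc i = j" | "j \<le> i" by linarith
  then show ?case
  proof cases
    case 1
    then show ?thesis by (simp add: coeff_eq_0 degree_newton_poly)
  next
    case 2
    then show ?thesis using lead_coeff_newton_poly[of r "Suc i"] by auto
  next
    case 3
    have "approx (case j of 0 \<Rightarrow> 0 | Suc j' \<Rightarrow> coeff (newton_poly r i) j') (L_disk D (Suc i) j)"
      using Suc.IH by (cases j) (simp_all del: L_disk.simps(3))
    from approx_diff[OF this approx_mult[OF Suc.IH[of j] D[of "Suc i"]]] show ?thesis
      using 3 by (simp add: newton_poly_Suc mult.commute coeff_pCons split: nat.splits)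
  qed
qed (auto simp: coeff_1)

text \<open>The recurrence turns into Pascal's rule. The coefficient of x^j is an elementary
  symmetric function of i roots, so R^(i-j) would be the natural power; R^i is coarser but
  independent of j.\<close>

lemma dbound_L_disk:
  assumes D: "\<And>k. k \<in> {1..i} \<Longrightarrow> dbound (D k) R q" and R: "1 \<le> R" and q: "1 \<le> q"
  shows "dbound (L_disk D (Suc i) (Suc j)) (of_nat (i choose j) * R ^ i) (q ^ i)"
  using D
proof (induction i arbitrary: j)
  case 0
  then show ?case by (cases j) (auto intro: dbound_zero dbound_one)
next
  case (Suc i)
  have q': "1 \<le> q ^ Suc i" using q by (rule one_le_power)
  consider "Suc i < j" | "Suc i = j" | "j \<le> i" by linarith
  then show ?case
  proof cases
    case 1
    then show ?thesis using q' by (simp add: dbound_zero binomial_eq_0)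
  next
    case 2
    have "1 \<le> R ^ Suc i" using R by (rule one_le_power)
    then show ?thesis using 2 dbound_mono[OF dbound_one[OF q']] by auto
  next
    case 3
    have IH: "dbound (L_disk D (Suc i) (Suc l)) (of_nat (i choose l) * R ^ i) (q ^ i)" for l
      using Suc by simp
    have Y: "dbound (L_disk D (Suc i) (Suc j) * D (Suc i)) (of_nat (i choose j) * R ^ Suc i) (q ^ Suc i)"
      using dbound_mult[OF IH Suc.prems[of "Suc i"]] by (simp add: mult_ac)
    show ?thesis
    proof (cases j)
      case 0
      then show ?thesis
        using dbound_diff[OF dbound_zero[OF q'] Y] by simp
    next
      case (Suc j')
      \<comment> \<open>This term is not multiplied by a disk; \<open>R\<close> and \<open>q\<close>
        are raised to match the other term before the two are subtracted.\<close>
      have "dbound (L_disk D (Suc i) j) (of_nat (i choose j') * R ^ Suc i) (q ^ Suc i)"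
        unfolding Suc by (rule dbound_mono[OF IH])
          (use R q in \<open>auto intro!: mult_left_mono power_increasing\<close>)
      from dbound_diff[OF this Y] show ?thesis
        using 3 Suc by (simp add: algebra_simps del: power_Suc)
    qed
  qed
qed

section \<open>Binomial sums and the weights of the exact factors\<close>

lemma sum_choose_lessThan: "(\<Sum>j<n. j choose k) = n choose Suc k"
  by (induction n) auto

text \<open>The binomial theorem for (2 + 1)^n without its first term. In the final sum,
  \<open>n choose Suc k\<close> comes from column k of V0^-1 and \<open>2 ^ Suc k\<close> from the
  weight of that column.\<close>

lemma sum_choose_Suc_power2: "(\<Sum>k<n. of_nat (n choose Suc k) * 2 ^ Suc k) \<le> (3 :: real) ^ n"
proof -
  have "(3 :: real) ^ n = (2 + 1) ^ n" by simp
  also have "\<dots> = (\<Sum>k\<le>n. of_nat (n choose k) * 2 ^ k)"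
    by (subst binomial_ring) simp
  also have "\<dots> = 1 + (\<Sum>k<n. of_nat (n choose Suc k) * 2 ^ Suc k)"
    by (subst sum.atMost_shift) simp
  finally show ?thesis by simp
qed

text \<open>The convolution identity expresses each coefficient through the earlier ones. After C^s
  is pulled out, the powers of 2 below s add up to 2^s - 1, which closes the induction with base 2
  C.\<close>

lemma norm_C_inv_coeff_le:
  fixes C :: real
  assumes c0: "c 0 = 1" and C: "1 \<le> C" "\<And>i. i \<in> {1..n} \<Longrightarrow> real_of_int \<bar>c i\<bar> \<le> C" and "s \<le> n"
  shows "cmod (C_inv_coeff c s) \<le> (2 * C) ^ s"
  using \<open>s \<le> n\<close>
proof (induction s rule: less_induct)
  case (less s)
  show ?case
  proof (cases "s = 0")
    case True
    then show ?thesis using C_inv_coeff_conv[of c 0, OF c0] c0 by simp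
  next
    case False
    have "(\<Sum>i\<le>s. of_int (c i) * C_inv_coeff c (s - i)) = 0"
      using C_inv_coeff_conv[of c s, OF c0] False by simp
    moreover have "{..s} = insert 0 {1..s}" by auto
    ultimately have "C_inv_coeff c s = - (\<Sum>i\<in>{1..s}. of_int (c i) * C_inv_coeff c (s - i))"
      using c0 by (simp add: add_eq_0_iff)
    then have "cmod (C_inv_coeff c s) \<le> (\<Sum>i\<in>{1..s}. cmod (of_int (c i) * C_inv_coeff c (s - i)))"
      by (simp add: norm_sum)
    also have "\<dots> \<le> (\<Sum>i\<in>{1..s}. C ^ s * 2 ^ (s - i))"
    proof (rule sum_mono)
      fix i assume i: "i \<in> {1..s}"
      have "cmod (of_int (c i)) \<le> C" using C(2)[of i] i less.prems by simp
      then have "cmod (of_int (c i) * C_inv_coeff c (s - i)) \<le> C * (2 * C) ^ (s - i)"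
        unfolding norm_mult using less.IH[of "s - i"] less.prems i C by (intro mult_mono) auto
      also have "\<dots> = C ^ Suc (s - i) * 2 ^ (s - i)"
        by (simp add: power_mult_distrib)
      also have "\<dots> \<le> C ^ s * 2 ^ (s - i)"
        using C i by (intro mult_right_mono power_increasing) auto
      finally show "cmod (of_int (c i) * C_inv_coeff c (s - i)) \<le> C ^ s * 2 ^ (s - i)" .
    qed
    also have "\<dots> = C ^ s * (\<Sum>u<s. 2 ^ u)"
      unfolding sum_distrib_left
      by (rule sum.reindex_bij_witness[of _ "\<lambda>u. s - u" "\<lambda>i. s - i"]) auto
    also have "(\<Sum>u<s. 2 ^ u) = (2 :: real) ^ s - 1"
      by (induction s) auto
    also have "C ^ s * (2 ^ s - 1) \<le> (2 * C) ^ s"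
      using C by (simp add: power_mult_distrib algebra_simps)
    finally show ?thesis .
  qed
qed

text \<open>The induction needs the closed form: the bound \<open>2 ^ (k + 2)\<close> alone would
  not reproduce itself.\<close>

lemma sum_Suc_power2: "(\<Sum>l\<le>k. of_nat (Suc l) * 2 ^ (k - l)) = (2 :: real) ^ (k + 2) - k - 3"
proof (induction k)
  case (Suc k)
  have "(\<Sum>l\<le>Suc k. of_nat (Suc l) * 2 ^ (Suc k - l)) =
      2 * (\<Sum>l\<le>k. of_nat (Suc l) * 2 ^ (k - l)) + (real k + 2)"
    by (simp add: sum_distrib_left Suc_diff_le mult_ac)
  then show ?case using Suc by simp
qed simp

text \<open>This is entry k of C^-1 \<Lambda>^-1 c with absolute values throughout, the weight of
  column k of V0^-1 in the final radius. The factor from c brings the power of C to k - l + 1 \<le>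
  n.\<close>

lemma sum_C_inv_c_le:
  fixes C :: real
  assumes c0: "c 0 = 1" and C: "1 \<le> C" "\<And>i. i \<in> {1..n} \<Longrightarrow> real_of_int \<bar>c i\<bar> \<le> C" and k: "k < n"
  shows "(\<Sum>l<n. cmod (inv_mat (C_mat n c) $$ (k, l)) * of_nat (Suc l) * real_of_int \<bar>c (Suc l)\<bar>)
    \<le> 2 * 2 ^ Suc k * C ^ n"
proof -
  have "(\<Sum>l<n. cmod (inv_mat (C_mat n c) $$ (k, l)) * of_nat (Suc l) * real_of_int \<bar>c (Suc l)\<bar>) =
      (\<Sum>l\<le>k. cmod (C_inv_coeff c (k - l)) * of_nat (Suc l) * real_of_int \<bar>c (Suc l)\<bar>)"
    unfolding inv_mat_C_mat(1)[of c n, OF c0]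
    by (rule sum.mono_neutral_cong_right) (use k in auto)
  also have "\<dots> \<le> (\<Sum>l\<le>k. C ^ n * (of_nat (Suc l) * 2 ^ (k - l)))"
  proof (rule sum_mono)
    fix l assume l: "l \<in> {..k}"
    have "cmod (C_inv_coeff c (k - l)) * of_nat (Suc l) * real_of_int \<bar>c (Suc l)\<bar>
        \<le> (2 * C) ^ (k - l) * of_nat (Suc l) * C"
      using l k C norm_C_inv_coeff_le[of c C n "k - l", OF c0 C]
      by (intro mult_mono mult_nonneg_nonneg) auto
    also have "\<dots> = C ^ Suc (k - l) * (of_nat (Suc l) * 2 ^ (k - l))"
      by (simp add: power_mult_distrib mult_ac)
    also have "\<dots> \<le> C ^ n * (of_nat (Suc l) * 2 ^ (k - l))"
      using C k by (intro mult_right_mono power_increasing) auto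
    finally show "cmod (C_inv_coeff c (k - l)) * of_nat (Suc l) * real_of_int \<bar>c (Suc l)\<bar>
        \<le> C ^ n * (of_nat (Suc l) * 2 ^ (k - l))" .
  qed
  also have "\<dots> = C ^ n * (2 ^ (k + 2) - real k - 3)"
    unfolding sum_distrib_left[symmetric] sum_Suc_power2 ..
  also have "\<dots> \<le> C ^ n * 2 ^ (k + 2)"
    using C by (intro mult_left_mono) auto
  finally show ?thesis by (simp add: mult_ac)
qed


section \<open>Positivity of the radii\<close>

lemma radius_mult_pos:
  assumes "0 < radius A" "0 \<le> radius B" "center B \<noteq> 0 \<or> 0 < radius B"
  shows "0 < radius (A * B)"
proof -
  have "0 < (cmod (center B) + radius B) * radius A"
    using assms by (intro mult_pos_pos) (auto intro: add_pos_nonneg add_nonneg_pos)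
  moreover have "0 \<le> cmod (center A) * radius B"
    using assms by simp
  ultimately show ?thesis by (simp add: algebra_simps)
qed

lemma prod_radius_pos:
  assumes "finite S" "S \<noteq> {}" "\<And>k. k \<in> S \<Longrightarrow> 0 < radius (F k)" "\<And>k. k \<in> S \<Longrightarrow> center (F k) \<noteq> 0"
  shows "0 < radius (prod F S) \<and> center (prod F S) \<noteq> 0"
  using assms by (induction S rule: finite_ne_induct) (auto intro!: add_pos_pos)

text \<open>Centers can vanish by cancellation, so the radius has to be followed as well: the
  diagonal is the exact 1, and below it the subtracted product has a positive radius, which no later
  subtraction can cancel.\<close>

lemma L_disk_nonzero:
  assumes D: "\<And>k. approx (r k) (D k)" "\<And>k. 0 < radius (D k)" and "j \<le> i"
  shows "center (L_disk D (Suc i) (Suc j)) \<noteq> 0 \<or> 0 < radius (L_disk D (Suc i) (Suc j))"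
  using \<open>j \<le> i\<close>
proof (induction i rule: dec_induct)
  case (step i)
  define A B where "A = L_disk D (Suc i) j" and "B = L_disk D (Suc i) (Suc j)"
  have L: "L_disk D (Suc (Suc i)) (Suc j) = A - B * D (Suc i)"
    using step by (simp add: A_def B_def)
  have "0 \<le> radius A"
    using approx_radius_nonneg[OF approx_L_disk[of r D i "j - 1"]] D(1)
    unfolding A_def by (cases j) auto
  moreover have B: "0 \<le> radius B"
    unfolding B_def by (rule approx_radius_nonneg[OF approx_L_disk]) (rule D(1))
  moreover have "0 < radius (B * D (Suc i))"
    using radius_mult_pos[OF D(2)[of "Suc i"] B] step.IH
    unfolding B_def[symmetric] by (simp only: mult.commute)
  ultimately show ?case unfolding L by simp
qed simp

text \<open>For n > 1 the last summand suffices: W is 1 in its last column, \<Delta> has a positive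
  radius, and the last row of L contains no exact zero. For n = 1 the sum is the exact 1, and
  \<open>recip (D i)\<close> alone supplies the radius.\<close>

lemma V0_inv_entry_radius_pos:
  assumes D: "\<And>k. approx (r k) (D k)" "\<And>k. 0 < radius (D k)" and i: "i \<in> {1..n}" and k: "k < n"
    and sep: "\<And>l. l \<in> {1..n} - {i} \<Longrightarrow> radius (D i - D l) < cmod (center (D i - D l))"
    and nz: "radius (D i) < cmod (center (D i))"
  shows "0 < radius (V0_inv_entry n D i k)"
proof -
  have recip: "0 < radius (recip A) \<and> center (recip A) \<noteq> 0"
    if "radius A < cmod (center A)" "0 < radius A" for A
  proof -
    have "(radius A)\<^sup>2 < (cmod (center A))\<^sup>2"
      using that by (intro power_strict_mono) auto
    then show ?thesis
      using that unfolding recip_simps[OF that(1)]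
      by (auto simp flip: of_real_power of_real_diff)
  qed
  define T where "T j = Delta_disk n D i * W_disk n D i (Suc j) * L_disk D (Suc j) (Suc k)" for j
  have rec: "approx (1 / (r i - r l)) (recip (D i - D l))" if "l \<in> {1..n} - {i}" for l
    by (rule approx_recip[OF approx_diff[OF D(1) D(1)] sep[OF that]])
  have T: "0 \<le> radius (T j)" for j
  proof -
    have W: "approx (W_exact n r i (Suc j)) (W_disk n D i (Suc j))"
      by (auto simp: W_exact_def W_disk_def intro!: approx_prod approx_diff D)
    have Delta: "approx (Delta_exact n r i) (Delta_disk n D i)"
      unfolding Delta_exact_def Delta_disk_def by (rule approx_prod) (rule rec)
    show ?thesis
      unfolding T_def
      by (rule approx_radius_nonneg[OF approx_mult[OF approx_mult[OF Delta W]
            approx_L_disk[OF D(1)]]])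
  qed
  define S where "S = (\<Sum>j<n. T j)"
  obtain n' where n': "n = Suc n'" using k by (cases n) auto
  have "W_disk n D i (Suc n') = 1"
    using i by (simp add: W_disk_def n')
  then have Tn: "T n' = Delta_disk n D i * L_disk D (Suc n') (Suc k)"
    by (simp add: T_def)
  have L: "center (L_disk D (Suc n') (Suc k)) \<noteq> 0 \<or> 0 < radius (L_disk D (Suc n') (Suc k))"
    by (rule L_disk_nonzero[of r]) (use D k n' in auto)
  have S: "0 \<le> radius S"
    unfolding S_def radius_sum by (rule sum_nonneg) (rule T)
  have "center S \<noteq> 0 \<or> 0 < radius S"
  proof (cases "n = 1")
    case True
    then show ?thesis using k i by (simp add: S_def T_def Delta_disk_def W_disk_def)
  next
    case False
    define l where "l = (if i = 1 then 2 else 1 :: nat)"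
    then have l: "l \<in> {1..n} - {i}"
      using False i by auto
    have "0 < radius (Delta_disk n D i) \<and> center (Delta_disk n D i) \<noteq> 0"
      unfolding Delta_disk_def
    proof (rule prod_radius_pos)
      fix l assume "l \<in> {1..n} - {i}"
      then have "0 < radius (recip (D i - D l)) \<and> center (recip (D i - D l)) \<noteq> 0"
        using sep D(2)[of i] D(2)[of l] by (intro recip) auto
      then show "0 < radius (recip (D i - D l))" "center (recip (D i - D l)) \<noteq> 0" by auto
    qed (use l in auto)
    moreover have "0 \<le> radius (L_disk D (Suc n') (Suc k))"
      by (rule approx_radius_nonneg[OF approx_L_disk]) (rule D(1))
    ultimately have "0 < radius (T n')"
      using L unfolding Tn by (intro radius_mult_pos) auto
    then have "0 < radius S"
      unfolding S_def radius_sum by (intro sum_pos2[of _ n']) (use T n' in auto)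
    then show ?thesis ..
  qed
  then show ?thesis
    unfolding V0_inv_entry_def T_def[symmetric] S_def[symmetric]
    using recip[OF nz D(2)] S by (intro radius_mult_pos) auto
qed

section \<open>Inclusion and error bounds for the entries of V0^-1\<close>

lemma approx_V0_inv_entry:
  assumes D: "\<And>k. approx (r k) (D k)"
    and sep: "\<And>l. l \<in> {1..n} - {i} \<Longrightarrow> radius (D i - D l) < cmod (center (D i - D l))"
    and nz: "radius (D i) < cmod (center (D i))"
  shows "approx (V0_inv_exact n r i k) (V0_inv_entry n D i k)"
proof -
  have "approx (1 / (r i - r l)) (recip (D i - D l))" if "l \<in> {1..n} - {i}" for l
    by (rule approx_recip[OF approx_diff[OF D D] sep[OF that]])
  then have "approx (Delta_exact n r i) (Delta_disk n D i)"
    unfolding Delta_exact_def Delta_disk_def by (rule approx_prod)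
  moreover have "approx (W_exact n r i (Suc j)) (W_disk n D i (Suc j))" for j
    by (auto simp: W_exact_def W_disk_def intro!: approx_prod approx_diff D)
  ultimately show ?thesis
    unfolding V0_inv_exact_def V0_inv_entry_def
    by (intro approx_mult approx_sum approx_L_disk approx_recip D nz)
qed

text \<open>\<open>\<eta>\<close> is the radius 2 \<epsilon> of a difference relative to the
  separation m. Summand j takes n-1 factors q from \<Delta>, n-1-j from W and j from L, so the total
  2(n-1) is the same for all j; likewise M^(n-1-j) R^j \<le> max(M,R)^(n-1). The reciprocal of
  \<open>D i\<close> has its own relative radius \<epsilon>/\<rho> and is kept apart.\<close>

lemma dbound_V0_inv_entry:
  fixes r :: "nat \<Rightarrow> complex" and \<epsilon> \<eta> m M R \<rho> :: real
  defines "D \<equiv> \<lambda>j. Disk (r j) \<epsilon>"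
  defines "q \<equiv> 1 / (1 - \<eta>)"
  assumes \<epsilon>: "0 < \<epsilon>" "2 * \<epsilon> = m * \<eta>" "\<epsilon> < \<rho>" and \<eta>: "\<eta> < 1"
    and m: "0 < m" "m \<le> 1" "\<And>l. l \<in> {1..n} - {i} \<Longrightarrow> m \<le> cmod (r i - r l)"
    and M: "1 \<le> M" "\<And>l. l \<in> {1..n} \<Longrightarrow> cmod (r i - r l) \<le> M"
    and R: "1 \<le> R" "\<And>l. l \<in> {1..n} \<Longrightarrow> cmod (r l) \<le> R"
    and \<rho>: "\<rho> \<le> cmod (r i)" and i: "i \<in> {1..n}"
  shows "dbound (V0_inv_entry n D i k)
      (1 / \<rho> * ((max M R / m) ^ (n - 1) * of_nat (n choose Suc k)))
      (1 / (1 - \<epsilon> / \<rho>) * q ^ (2 * (n - 1)))"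
    and "\<And>l. l \<in> {1..n} - {i} \<Longrightarrow> radius (D i - D l) < cmod (center (D i - D l))"
    and "radius (D i) < cmod (center (D i))"
proof -
  define K where "K = max M R"
  have \<eta>0: "0 < \<eta>"
    using \<epsilon> m by (metis mult_pos_pos zero_less_mult_pos zero_less_numeral)
  have q: "1 \<le> q" using \<eta> \<eta>0 by (simp add: q_def)
  \<comment> \<open>As m \<le> 1, this bounds the radii of differences by M (q - 1) and those of the
    root disks by R (q - 1), so one factor q serves \<Delta>, W and L.\<close>
  have q\<eta>: "\<eta> \<le> q - 1" using \<eta> \<eta>0 by (simp add: q_def field_simps)
  have r1: "dbound (recip (D i)) (1 / \<rho>) (1 / (1 - \<epsilon> / \<rho>))" and nz: "radius (D i) < cmod (center (D i))"
    using \<epsilon> \<rho> by (auto intro!: dbound_recip[of _ \<rho> "\<epsilon> / \<rho>"] simp: D_def)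
  show "radius (D i) < cmod (center (D i))" by (rule nz)
  have r2: "dbound (recip (D i - D l)) (1 / m) q" "radius (D i - D l) < cmod (center (D i - D l))"
    if "l \<in> {1..n} - {i}" for l
    using dbound_recip[of "D i - D l" m \<eta>] m that \<epsilon> \<eta> by (auto simp: D_def q_def)
  then show "\<And>l. l \<in> {1..n} - {i} \<Longrightarrow> radius (D i - D l) < cmod (center (D i - D l))"
    by blast
  have Delta: "dbound (Delta_disk n D i) ((1 / m) ^ (n - 1)) (q ^ (n - 1))"
    using dbound_prod[of "{1..n} - {i}" "\<lambda>l. recip (D i - D l)" "1 / m" q] r2(1) q i
    by (simp add: Delta_disk_def)
  have diff: "dbound (D i - D l) M q" if "l \<in> {1..n}" for l
  proof (rule dbound_disk)
    have "m * \<eta> \<le> 1 * (q - 1)"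
      using m \<eta>0 q\<eta> by (intro mult_mono) auto
    also have "\<dots> \<le> M * (q - 1)"
      using M q by (intro mult_right_mono) auto
    finally show "radius (D i - D l) \<le> M * (q - 1)"
      using \<epsilon> by (simp add: D_def)
  qed (use q M that \<epsilon> in \<open>auto simp: D_def\<close>)
  have W: "dbound (W_disk n D i (Suc j)) (M ^ (n - 1 - j)) (q ^ (n - 1 - j))" if "j < n" for j
  proof (cases "i > Suc j")
    case True
    then show ?thesis
      using M q dbound_mono[OF dbound_zero[of "q ^ (n - 1 - j)"], of "M ^ (n - 1 - j)" "q ^ (n - 1 - j)"]
      by (simp add: W_disk_def one_le_power)
  next
    case False
    then have "{Suc j + 1..n} - {i} = {Suc j + 1..n}" by auto
    moreover have "card {Suc j + 1..n} = n - 1 - j" by simp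
    moreover have "dbound (\<Prod>l\<in>{Suc j + 1..n}. D i - D l)
        (M ^ card {Suc j + 1..n}) (q ^ card {Suc j + 1..n})"
      by (rule dbound_prod) (auto intro: diff q)
    ultimately show ?thesis
      using False by (simp add: W_disk_def)
  qed
  have Dk: "dbound (D l) R q" if "l \<in> {1..n}" for l
  proof (rule dbound_disk)
    have "\<epsilon> \<le> m * \<eta>" using \<epsilon> by simp
    also have "\<dots> \<le> 1 * (q - 1)"
      using m \<eta>0 q\<eta> by (intro mult_mono) auto
    also have "\<dots> \<le> R * (q - 1)"
      using R q by (intro mult_right_mono) auto
    finally show "radius (D l) \<le> R * (q - 1)"
      by (simp add: D_def)
  qed (use q R that \<epsilon> in \<open>auto simp: D_def\<close>)
  have L: "dbound (L_disk D (Suc j) (Suc k)) (of_nat (j choose k) * R ^ j) (q ^ j)" if "j < n" for j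
    by (rule dbound_L_disk) (use that Dk R q in auto)
  have T: "dbound (Delta_disk n D i * W_disk n D i (Suc j) * L_disk D (Suc j) (Suc k))
      ((K / m) ^ (n - 1) * of_nat (j choose k)) (q ^ (2 * (n - 1)))" if "j < n" for j
  proof (rule dbound_mono[OF dbound_mult[OF dbound_mult[OF Delta W] L]])
    have "M ^ (n - 1 - j) * R ^ j \<le> K ^ (n - 1 - j) * K ^ j"
      using M R by (intro mult_mono power_mono) (auto simp: K_def)
    also have "\<dots> = K ^ (n - 1)"
      using that by (simp flip: power_add)
    finally have "(1 / m) ^ (n - 1) * (M ^ (n - 1 - j) * R ^ j) * of_nat (j choose k)
        \<le> (1 / m) ^ (n - 1) * K ^ (n - 1) * of_nat (j choose k)"
      using m by (intro mult_right_mono mult_left_mono) auto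
    then show "(1 / m) ^ (n - 1) * M ^ (n - 1 - j) * (of_nat (j choose k) * R ^ j)
        \<le> (K / m) ^ (n - 1) * of_nat (j choose k)"
      by (simp add: power_divide mult_ac)
    have "q ^ (n - 1) * q ^ (n - 1 - j) * q ^ j = q ^ (n - 1 + (n - 1 - j) + j)"
      by (simp only: power_add)
    also have "n - 1 + (n - 1 - j) + j = 2 * (n - 1)" using that by simp
    finally show "q ^ (n - 1) * q ^ (n - 1 - j) * q ^ j \<le> q ^ (2 * (n - 1))" by simp
  qed (use that in auto)
  have "dbound (\<Sum>j<n. Delta_disk n D i * W_disk n D i (Suc j) * L_disk D (Suc j) (Suc k))
      (\<Sum>j<n. (K / m) ^ (n - 1) * of_nat (j choose k)) (q ^ (2 * (n - 1)))"
    by (rule dbound_sum) (use T q in \<open>auto intro: one_le_power\<close>)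
  moreover have "(\<Sum>j<n. (K / m) ^ (n - 1) * real (j choose k)) = (K / m) ^ (n - 1) * of_nat (n choose Suc k)"
    by (simp only: sum_distrib_left[symmetric] of_nat_sum[symmetric] sum_choose_lessThan)
  ultimately show "dbound (V0_inv_entry n D i k)
      (1 / \<rho> * ((max M R / m) ^ (n - 1) * of_nat (n choose Suc k)))
      (1 / (1 - \<epsilon> / \<rho>) * q ^ (2 * (n - 1)))"
    unfolding V0_inv_entry_def K_def[symmetric] by (intro dbound_mult[OF r1]) simp
qed

text \<open>Multiplication by an exact number scales the radius by its modulus, and addition adds
  radii; hence the final radius is linear in the radii of V0^-1.\<close>

lemma radius_multiplicity_disks:
  assumes c0: "c 0 = 1" and i: "i < n"
  shows "radius (multiplicity_disks n c D $ i) =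
    (\<Sum>k<n. radius (V0_inv_entry n D (Suc i) k) *
      (\<Sum>l<n. cmod (inv_mat (C_mat n c) $$ (k, l)) * of_nat (Suc l) * real_of_int \<bar>c (Suc l)\<bar>))"
proof -
  have "radius (multiplicity_disks n c D $ i) =
      (\<Sum>l<n. \<Sum>k<n. radius (V0_inv_entry n D (Suc i) k) *
        (cmod (inv_mat (C_mat n c) $$ (k, l)) * of_nat (Suc l) * real_of_int \<bar>c (Suc l)\<bar>))"
    unfolding multiplicity_disks_nth[of c i n, OF c0 i] radius_sum
    by (simp add: radius_sum sum_distrib_left sum_distrib_right norm_minus_cancel mult_ac
        del: of_nat_Suc)
  also have "\<dots> = (\<Sum>k<n. radius (V0_inv_entry n D (Suc i) k) *
      (\<Sum>l<n. cmod (inv_mat (C_mat n c) $$ (k, l)) * of_nat (Suc l) * real_of_int \<bar>c (Suc l)\<bar>))"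
    by (subst sum.swap) (simp only: sum_distrib_left)
  finally show ?thesis .
qed

section \<open>The numerical estimate\<close>

lemma growth_factor_le:
  fixes a \<eta> :: real
  assumes "0 \<le> a" "0 \<le> \<eta>" "a + N * \<eta> \<le> 1 / 2"
  shows "1 / (1 - a) * (1 / (1 - \<eta>)) ^ N - 1 \<le> 2 * (a + N * \<eta>)"
proof -
  define s where "s = a + N * \<eta>"
  have s: "0 \<le> s" "s \<le> 1 / 2" "0 \<le> N * \<eta>" using assms by (auto simp: s_def)
  have a: "a \<le> 1 / 2" using assms s by linarith
  have N: "1 - N * \<eta> \<le> (1 - \<eta>) ^ N" if "N \<noteq> 0"
  proof -
    have "1 * \<eta> \<le> N * \<eta>" using that assms by (intro mult_right_mono) auto
    then have "\<eta> \<le> 1" using s a assms by linarith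
    then show ?thesis using Bernoulli_inequality[of "- \<eta>" N] by simp
  qed
  \<comment> \<open>Bernoulli's inequality makes the denominator at least 1 - s, and 1/(1 - s) \<le>
    1 + 2 s for s \<le> 1/2.\<close>
  have "1 - s \<le> (1 - a) * (1 - N * \<eta>)"
    using assms s by (simp add: s_def algebra_simps)
  also have "\<dots> \<le> (1 - a) * (1 - \<eta>) ^ N"
    using N a by (cases "N = 0") (auto intro!: mult_left_mono)
  finally have P: "1 - s \<le> (1 - a) * (1 - \<eta>) ^ N" .
  then have "0 < (1 - a) * (1 - \<eta>) ^ N" using s by linarith
  then have "0 < ((1 - a) * (1 - \<eta>) ^ N) * (1 - s)"
    by (rule mult_pos_pos) (use s in simp)
  then have "1 / ((1 - a) * (1 - \<eta>) ^ N) \<le> 1 / (1 - s)"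
    by (rule divide_left_mono[OF P zero_le_one])
  also have "\<dots> \<le> 1 + 2 * s"
  proof -
    have "s * (2 * s) \<le> s * 1" using s by (intro mult_left_mono) auto
    then show ?thesis using s by (simp add: field_simps)
  qed
  finally show ?thesis by (simp add: s_def power_one_over)
qed

text \<open>To first order the error is 4 3^n/\<rho> times 1/\<rho> + 4n/m times \<epsilon>
  (K/m)^(n-1) C^n; one factor 2 of the 4 comes from \<open>growth_factor_le\<close>. In the
  hypothesis 2^(2n+7) = 128 4^n leaves at most 1/32 of 4 3^n, m^(n+2) against (1/m)^(n-1) leaves
  m^3, which covers 1/m, and \<open>root\<close> disposes of the second 1/\<rho>. At most 5n/(32
  n^5) remains.\<close>

lemma radius_estimate:
  fixes \<epsilon> m M R C \<rho> :: real
  assumes n: "n \<ge> 1" and \<epsilon>: "0 < \<epsilon>"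
    "\<epsilon> < m\<^sup>2 * \<rho> / (2 ^ (2 * n + 7) * real n ^ 5) * (m / (M * R * C)) ^ n"
    and m: "0 < m" "m \<le> 1" and \<rho>: "0 < \<rho>" "\<rho> \<le> 1" and M: "1 \<le> M" and R: "1 \<le> R" and C: "1 \<le> C"
    and root: "1 \<le> \<rho> * (n * min M R ^ (n - 1))"
  shows "2 * \<epsilon> / m < 1" and "\<epsilon> < \<rho>"
    and "1 / \<rho> * (max M R / m) ^ (n - 1) * (1 / (1 - \<epsilon> / \<rho>) * (1 / (1 - 2 * \<epsilon> / m)) ^ (2 * (n - 1)) - 1)
       * 2 * 3 ^ n * C ^ n < 1 / 2"
proof -
  define K k where "K = max M R" and "k = min M R"
  have Kk: "1 \<le> K" "1 \<le> k" "M * R = K * k"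
    using M R by (auto simp: K_def k_def max_def min_def)
  have n1: "1 \<le> real n" "real n \<le> real n ^ 5"
    using n self_le_power[of "real n" 5] by auto
  \<comment> \<open>512 is \<open>2 ^ (2 * n + 7)\<close> at n = 1. This crude consequence settles
    the side conditions up to s \<le> 1/2; the full hypothesis enters in \<open>key\<close>.\<close>
  have small: "\<epsilon> * (512 * real n ^ 5) < m\<^sup>2 * \<rho>"
  proof -
    have "(m / (M * R * C)) ^ n \<le> 1"
      using m M R C mult_mono[of 1 M 1 R] mult_mono[of 1 "M * R" 1 C]
      by (intro power_le_one) (auto simp: divide_le_eq_1)
    then have "m\<^sup>2 * \<rho> / (2 ^ (2 * n + 7) * real n ^ 5) * (m / (M * R * C)) ^ n
        \<le> m\<^sup>2 * \<rho> / (2 ^ (2 * n + 7) * real n ^ 5) * 1"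
      using \<rho> by (intro mult_left_mono) auto
    then have "\<epsilon> < m\<^sup>2 * \<rho> / (2 ^ (2 * n + 7) * real n ^ 5) * 1"
      using \<epsilon>(2) by linarith
    then have "\<epsilon> * (2 ^ (2 * n + 7) * real n ^ 5) < m\<^sup>2 * \<rho>"
      using n by (simp add: field_simps)
    moreover have "(2 :: real) ^ 9 \<le> 2 ^ (2 * n + 7)"
      using n by (intro power_increasing) auto
    then have "\<epsilon> * (512 * real n ^ 5) \<le> \<epsilon> * (2 ^ (2 * n + 7) * real n ^ 5)"
      using \<epsilon> by (intro mult_left_mono mult_right_mono) auto
    ultimately show ?thesis by linarith
  qed
  have mm: "m\<^sup>2 \<le> m" "m\<^sup>2 \<le> 1"
    using m by (auto simp: power2_eq_square mult_le_cancel_left1 mult_le_one)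
  have small1: "\<epsilon> * (512 * real n) \<le> \<epsilon> * (512 * real n ^ 5)"
    using \<epsilon> n1 by (intro mult_left_mono) auto
  have "m\<^sup>2 * \<rho> \<le> 1 * \<rho>" using mm \<rho> by (intro mult_right_mono) auto
  then have e\<rho>: "\<epsilon> * (512 * real n) < \<rho>" using small small1 by linarith
  have "m\<^sup>2 * \<rho> \<le> m * 1" using mm \<rho> m by (intro mult_mono) auto
  then have em: "\<epsilon> * (512 * real n) < m" using small small1 by linarith
  have e512: "\<epsilon> * 512 \<le> \<epsilon> * (512 * real n)" using \<epsilon> n1 by simp
  have "2 * \<epsilon> < m"
    using em e512 \<epsilon>(1) by linarith
  then show "2 * \<epsilon> / m < 1"
    using m by simp
  show "\<epsilon> < \<rho>"
    using e\<rho> e512 \<epsilon>(1) by linarith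
  define s where "s = \<epsilon> / \<rho> + real (2 * (n - 1)) * (2 * \<epsilon> / m)"
  have s: "s \<le> \<epsilon> * (1 / \<rho> + 4 * real n / m)"
    using n m \<epsilon> by (simp add: s_def of_nat_diff field_simps)
  also have "\<dots> \<le> 1 / 2"
  proof -
    have "\<epsilon> * 4 \<le> \<rho>" using e\<rho> e512 \<epsilon>(1) by linarith
    then have "\<epsilon> / \<rho> \<le> 1 / 4" using \<rho> by (simp add: field_simps)
    moreover have "4 * \<epsilon> * real n * 4 \<le> m"
    proof -
      have "0 \<le> \<epsilon> * real n" "4 * \<epsilon> * real n * 4 = 16 * (\<epsilon> * real n)" "\<epsilon> * (512 * real n) = 512 * (\<epsilon> * real n)"
        using \<epsilon>(1) by simp_all
      then show "4 * \<epsilon> * real n * 4 \<le> m" using em by linarith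
    qed
    then have "4 * \<epsilon> * real n / m \<le> 1 / 4" using m by (simp add: field_simps)
    moreover have "\<epsilon> * (1 / \<rho> + 4 * real n / m) = \<epsilon> / \<rho> + 4 * \<epsilon> * real n / m"
      by (simp add: distrib_left)
    ultimately show ?thesis by linarith
  qed
  finally have "s \<le> 1 / 2" .
  then have x: "1 / (1 - \<epsilon> / \<rho>) * (1 / (1 - 2 * \<epsilon> / m)) ^ (2 * (n - 1)) - 1 \<le> 2 * s"
    unfolding s_def using \<epsilon> m \<rho> by (intro growth_factor_le) auto
  have "\<epsilon> * (K / m) ^ (n - 1) * C ^ n * (2 ^ (2 * n + 7) * real n ^ 5 * k ^ (n - 1)) \<le> m ^ 3 * \<rho>"
  proof -
    have "\<epsilon> * d \<le> a * b" if "\<epsilon> < a / d * b" "0 < d" for a b d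
      using that by (simp add: field_simps)
    from this[OF \<epsilon>(2)]
    have "\<epsilon> * (2 ^ (2 * n + 7) * real n ^ 5) \<le> m\<^sup>2 * \<rho> * (m / (M * R * C)) ^ n"
      using n by simp
    then have "\<epsilon> * (2 ^ (2 * n + 7) * real n ^ 5) * ((K / m) ^ (n - 1) * C ^ n * k ^ (n - 1))
        \<le> m\<^sup>2 * \<rho> * (m / (M * R * C)) ^ n * ((K / m) ^ (n - 1) * C ^ n * k ^ (n - 1))"
      using Kk m C by (intro mult_right_mono) auto
    \<comment> \<open>By M R = K k, the powers K^(n-1) and k^(n-1) cancel against (M R)^n and only
      1/(K k) \<le> 1 is left.\<close>
    also have "\<dots> = m\<^sup>2 * \<rho> * m * (1 / (K * k))"
    proof -
      obtain n' where n': "n = Suc n'" using n by (cases n) auto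
      show ?thesis
        unfolding Kk(3) n' using Kk m C by (simp add: power_divide power_mult_distrib field_simps)
    qed
    also have "\<dots> \<le> m\<^sup>2 * \<rho> * m * 1"
      using Kk m \<rho> mult_mono[of 1 K 1 k] by (intro mult_left_mono) auto
    finally show ?thesis by (simp add: power2_eq_square power3_eq_cube mult_ac)
  qed
  then have key: "\<epsilon> * (K / m) ^ (n - 1) * C ^ n \<le> m ^ 3 * \<rho> / (2 ^ (2 * n + 7) * real n ^ 5 * k ^ (n - 1))"
    using n Kk by (simp add: pos_le_divide_eq)
  have "1 / \<rho> * (K / m) ^ (n - 1) * (1 / (1 - \<epsilon> / \<rho>) * (1 / (1 - 2 * \<epsilon> / m)) ^ (2 * (n - 1)) - 1)
       * 2 * 3 ^ n * C ^ n
     \<le> 1 / \<rho> * (K / m) ^ (n - 1) * (2 * (\<epsilon> * (1 / \<rho> + 4 * real n / m))) * 2 * 3 ^ n * C ^ n"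
    using x s \<rho> m Kk C by (intro mult_right_mono mult_left_mono) auto
  also have "\<dots> = (4 * 3 ^ n / \<rho> * (1 / \<rho> + 4 * real n / m)) * (\<epsilon> * (K / m) ^ (n - 1) * C ^ n)"
    by (simp add: mult_ac)
  also have "\<dots> \<le> (4 * 3 ^ n / \<rho> * (1 / \<rho> + 4 * real n / m))
      * (m ^ 3 * \<rho> / (2 ^ (2 * n + 7) * real n ^ 5 * k ^ (n - 1)))"
    using key \<rho> m by (intro mult_left_mono) auto
  also have "\<dots> = (3 ^ n / 4 ^ n) * (m ^ 3 * (1 / (\<rho> * k ^ (n - 1))) + 4 * real n * m\<^sup>2 * (1 / k ^ (n - 1)))
      / (32 * real n ^ 5)"
  proof -
    have "(2 :: real) ^ (2 * n + 7) = 4 ^ n * 128"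
      by (simp add: power_add power_mult)
    then show ?thesis
      using m \<rho> Kk n by (simp add: field_simps power2_eq_square power3_eq_cube)
  qed
  also have "\<dots> \<le> 1 * (1 * real n + 4 * real n * 1 * 1) / (32 * real n ^ 5)"
  proof (intro divide_right_mono mult_mono add_mono)
    show "1 / (\<rho> * k ^ (n - 1)) \<le> real n"
      using root \<rho> Kk unfolding k_def[symmetric] by (simp add: field_simps)
    show "1 / k ^ (n - 1) \<le> 1" using Kk by (simp add: one_le_power)
    show "(3 :: real) ^ n / 4 ^ n \<le> 1" by (simp add: power_mono)
    show "m ^ 3 \<le> 1" using m by (intro power_le_one) auto
  qed (use m \<rho> Kk mm in auto)
  also have "\<dots> < 1 / 2"
  proof -
    have "real n * 5 < 16 * real n ^ 5" using n1 by linarith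
    then show ?thesis using n by (simp add: field_simps)
  qed
  finally show "1 / \<rho> * (max M R / m) ^ (n - 1)
       * (1 / (1 - \<epsilon> / \<rho>) * (1 / (1 - 2 * \<epsilon> / m)) ^ (2 * (n - 1)) - 1) * 2 * 3 ^ n * C ^ n < 1 / 2"
    by (simp add: K_def)
qed

section \<open>Uniqueness of the integer and the theorem\<close>

lemma ex1_int_in_disk_set:
  assumes "of_int k \<in> disk_set A" "radius A \<le> 1 / 2"
  shows "\<exists>!k::int. of_int k \<in> disk_set A"
proof (rule ex1I[of _ k])
  fix l :: int assume "of_int l \<in> disk_set A"
  \<comment> \<open>The ball is open, so even radius 1/2 keeps its points at distance strictly below
    1.\<close>
  then have "dist (of_int l :: complex) (of_int k) < 1"
    using assms dist_triangle_half_r[of "center A" "of_int l :: complex" 1 "of_int k"]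
    by (simp add: disk_set_def)
  then have "cmod (of_int (l - k)) < 1"
    by (simp add: dist_norm)
  then have "\<bar>l - k\<bar> < 1"
    by (simp only: norm_of_int)
  then show "l = k" by simp
qed (rule assms)

theorem theorem3p1:
  fixes p :: "int poly" and t n :: nat
    and c :: "nat \<Rightarrow> int" and r :: "nat \<Rightarrow> complex"
    and M m R rmin cmax \<epsilon> :: real
  assumes "p = (\<Sum>i\<le>t. monom (c i) (t - i))" and "c 0 = 1"
    and "n \<ge> 1"
    and "inj_on r {1..n}"
    and "r ` {1..n} = {z. z \<noteq> 0 \<and> poly (map_poly of_int p) z = 0}"
    and "\<And>i j. 1 \<le> i \<Longrightarrow> i \<le> j \<Longrightarrow> j \<le> n \<Longrightarrow> cmod (r j) \<le> cmod (r i)"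
    and "M = max (Max {cmod (r i - r j) | i j. i \<in> {1..n} \<and> j \<in> {1..n}}) 1"
    and "m = Min (insert 1 {cmod (r i - r j) | i j. i \<in> {1..n} \<and> j \<in> {1..n} \<and> i \<noteq> j})"
    and "R = max (cmod (r 1)) 1" and "rmin = min (cmod (r n)) 1"
    and "cmax = max (Max ((\<lambda>i. real_of_int \<bar>c i\<bar>) ` {1..n})) 1"
    and "\<epsilon> > 0"
    and "\<epsilon> < m\<^sup>2 * rmin / (2 ^ (2 * n + 7) * real n ^ 5) * (m / (M * R * cmax)) ^ n"
  shows "\<forall>i\<in>{1..n}.
     of_nat (order (r i) (map_poly of_int p)) =
       (inv_mat (Lambda_mat n * C_mat n c * V0_mat n r) *\<^sub>v c_vec n c) $ (i - 1) \<and>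
     (\<exists>!k::int. of_int k \<in> disk_set (multiplicity_disks n c (\<lambda>j. Disk (r j) \<epsilon>) $ (i - 1)))"
proof
  note p = assms(1) and c0 = assms(2) and n = assms(3) and inj = assms(4) and roots = assms(5)
    and mono = assms(6)
  fix i assume i: "i \<in> {1..n}"
  then obtain i' where i': "i = Suc i'" "i' < n"
    by (cases i) auto
  have P: "cpoly p = (\<Sum>i\<le>t. monom (of_int (c i)) (t - i))"
    unfolding p by (rule poly_eqI) (auto simp: coeff_map_poly coeff_sum intro!: sum.cong)
  have "degree (cpoly p) = t"
    unfolding P by (rule degree_sum_monom_diff) (simp add: c0)
  then have degree: "degree p = t" by simp
  have lead: "lead_coeff p = 1"
    unfolding degree unfolding p using coeff_sum_monom_diff[of 0 t c] c0 by simp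
  then have "p \<noteq> 0" by auto
  have fin: "finite {z. poly (cpoly p) z = 0}"
    by (rule poly_roots_finite) (simp add: \<open>p \<noteq> 0\<close>)
  have card: "card {z. z \<noteq> 0 \<and> poly (cpoly p) z = 0} = n"
    using card_image[OF inj] unfolding roots by simp
  \<comment> \<open>At most t distinct roots exist, so c 1, ..., c n are all coefficients of
    p.\<close>
  have "n \<le> card {z. poly (cpoly p) z = 0}"
    unfolding card[symmetric] by (rule card_mono[OF fin]) auto
  also have "\<dots> \<le> t"
    using card_poly_roots_bound[of "cpoly p"] \<open>p \<noteq> 0\<close> degree by simp
  finally have "n \<le> t" .
  note exact_value = multiplicity_vector[of c n t r i', OF c0 \<open>n \<le> t\<close> inj _ i'(2), folded P, OF roots]

  have root: "r l \<noteq> 0" "poly (cpoly p) (r l) = 0" if "l \<in> {1..n}" for l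
    using that roots by blast+
  have M: "1 \<le> M" "cmod (r a - r b) \<le> M" if "a \<in> {1..n}" "b \<in> {1..n}" for a b
  proof -
    have "finite {cmod (r i - r j) | i j. i \<in> {1..n} \<and> j \<in> {1..n}}"
      by (rule finite_image_set2) auto
    then have "cmod (r a - r b) \<le> Max {cmod (r i - r j) | i j. i \<in> {1..n} \<and> j \<in> {1..n}}"
      using that by (intro Max_ge) auto
    then show "1 \<le> M" "cmod (r a - r b) \<le> M"
      unfolding assms(7) by auto
  qed
  define E where "E = {cmod (r i - r j) | i j. i \<in> {1..n} \<and> j \<in> {1..n} \<and> i \<noteq> j}"
  have "E \<subseteq> {cmod (r i - r j) | i j. i \<in> {1..n} \<and> j \<in> {1..n}}"
    unfolding E_def by blast
  moreover have "finite {cmod (r i - r j) | i j. i \<in> {1..n} \<and> j \<in> {1..n}}"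
    by (rule finite_image_set2) auto
  ultimately have "finite (insert 1 E)"
    using finite_subset by blast
  moreover have m_eq: "m = Min (insert 1 E)"
    unfolding assms(8) E_def ..
  ultimately have m1: "m \<le> 1" and mE: "\<And>x. x \<in> E \<Longrightarrow> m \<le> x" and "m \<in> insert 1 E"
    using Min_in[of "insert 1 E"] by auto
  have m: "m \<le> cmod (r a - r b)" if "a \<in> {1..n}" "b \<in> {1..n}" "a \<noteq> b" for a b
    by (rule mE) (use that in \<open>auto simp: E_def\<close>)
  have m0: "0 < m"
    \<comment> \<open>The minimum is attained, either by 1 or by the distance of two roots, which is
      positive by injectivity.\<close>
    using \<open>m \<in> insert 1 E\<close> by (auto simp: E_def inj_on_eq_iff[OF inj])
  have R: "1 \<le> R" "cmod (r l) \<le> R" if "l \<in> {1..n}" for l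
    using mono[of 1 l] that by (auto simp: assms(9))
  have \<rho>: "0 < rmin" "rmin \<le> 1" "rmin \<le> cmod (r l)" if "l \<in> {1..n}" for l
    using mono[of l n] that root[of n] n by (auto simp: assms(10))
  have C: "1 \<le> cmax" "real_of_int \<bar>c l\<bar> \<le> cmax" if "l \<in> {1..n}" for l
  proof -
    have "real_of_int \<bar>c l\<bar> \<le> Max ((\<lambda>i. real_of_int \<bar>c i\<bar>) ` {1..n})"
      using that by (intro Max_ge) auto
    then show "1 \<le> cmax" "real_of_int \<bar>c l\<bar> \<le> cmax"
      unfolding assms(11) by auto
  qed
  note M1 = M(1)[OF i i] and R1 = R(1)[OF i] and C1 = C(1)[OF i]
  have "1 \<le> min (cmod (r n)) 1 * (card {z. z \<noteq> 0 \<and> poly (cpoly p) z = 0}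
      * min M R ^ (card {z. z \<noteq> 0 \<and> poly (cpoly p) z = 0} - 1))"
  proof (rule inverse_norm_root_le[OF lead _ R1 _ M1])
    show "r n \<in> {z. z \<noteq> 0 \<and> poly (cpoly p) z = 0}"
      using n root[of n] by simp
  next
    fix w assume "w \<in> {z. z \<noteq> 0 \<and> poly (cpoly p) z = 0}"
    then obtain l where "l \<in> {1..n}" "w = r l"
      unfolding roots[symmetric] by blast
    then show "cmod w \<le> R" "cmod (w - r n) \<le> M"
      using R(2) M(2)[of l n] n by auto
  qed
  then have root_bound: "1 \<le> rmin * (n * min M R ^ (n - 1))"
    unfolding card assms(10) .
  note est = radius_estimate[OF n assms(12,13) m0 m1 \<rho>(1,2)[OF i] M1 R1 C1 root_bound]

  define D where "D = (\<lambda>j. Disk (r j) \<epsilon>)"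
  have D: "approx (r l) (D l)" "0 < radius (D l)" for l
    using assms(12) by (auto simp: D_def approx_def)
  \<comment> \<open>This fixes \<open>\<eta>\<close> in \<open>dbound_V0_inv_entry\<close> as 2
    \<epsilon>/m.\<close>
  have eps: "2 * \<epsilon> = m * (2 * \<epsilon> / m)" using m0 by simp
  have V: "dbound (V0_inv_entry n D i k)
        (1 / rmin * ((max M R / m) ^ (n - 1) * of_nat (n choose Suc k)))
        (1 / (1 - \<epsilon> / rmin) * (1 / (1 - 2 * \<epsilon> / m)) ^ (2 * (n - 1)))"
    "\<And>l. l \<in> {1..n} - {i} \<Longrightarrow> radius (D i - D l) < cmod (center (D i - D l))"
    "radius (D i) < cmod (center (D i))" for k
    unfolding D_def
    by (rule dbound_V0_inv_entry[where r = r and i = i and n = n, OF assms(12) eps est(2,1) m0 m1 _ M1 _ R1 _ \<rho>(3)[OF i] i];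
        use m[OF i] M(2)[OF i] R(2) in auto)+

  define A where "A = multiplicity_disks n c D $ i'"
  have approx_A: "approx (of_nat (order (r i) (cpoly p))) A"
  proof -
    have "approx (V0_inv_exact n r i k) (V0_inv_entry n D i k)" for k
      by (rule approx_V0_inv_entry[where D = D and r = r and i = i, OF D(1) V(2,3)])
    then have "approx (\<Sum>l<n. (\<Sum>k<n. V0_inv_exact n r (Suc i') k * inv_mat (C_mat n c) $$ (k, l))
         * (- of_nat (Suc l)) * of_int (c (Suc l))) A"
      unfolding A_def multiplicity_disks_nth[of c i' n, OF c0 i'(2)] i'(1)
      by (intro approx_sum approx_mult approx_exact)
    then show ?thesis
      unfolding exact_value(2) i'(1) .
  qed
  have H: "0 \<le> (\<Sum>l<n. cmod (inv_mat (C_mat n c) $$ (k, l)) * of_nat (Suc l) * real_of_int \<bar>c (Suc l)\<bar>)" for k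
    by (intro sum_nonneg mult_nonneg_nonneg) auto
  have V_pos: "0 < radius (V0_inv_entry n D i k)" if "k < n" for k
    by (rule V0_inv_entry_radius_pos[where D = D and r = r and i = i, OF D i that V(2,3)])
  have "0 < radius A"
  proof -
    \<comment> \<open>If c 1, ..., c n all vanished, the computation would end in the exact 0. A
      positive multiplicity excludes this, and the diagonal entry 1 of C^-1 then gives some column a
      positive weight.\<close>
    have "order (r i) (cpoly p) \<noteq> 0"
      using root[OF i] \<open>p \<noteq> 0\<close> by (simp add: order_root)
    then have "\<exists>l<n. c (Suc l) \<noteq> 0"
      using exact_value(2) i'(1) by (auto intro: ccontr)
    then obtain l where l: "l < n" "c (Suc l) \<noteq> 0" by blast
    have "inv_mat (C_mat n c) $$ (l, l) = 1"
      using C_inv_coeff_conv[of c 0, OF c0] c0 l unfolding inv_mat_C_mat(1)[of c n, OF c0] by simp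
    then have S_pos: "0 < (\<Sum>j<n. cmod (inv_mat (C_mat n c) $$ (l, j)) * of_nat (Suc j) * real_of_int \<bar>c (Suc j)\<bar>)"
      using l by (intro sum_pos2[of _ l]) (auto intro!: mult_nonneg_nonneg)
    show ?thesis
      unfolding A_def radius_multiplicity_disks[of c i' n, OF c0 i'(2)] i'(1)[symmetric]
      by (rule sum_pos2[of _ l])
        (use V_pos H l S_pos in \<open>auto intro!: mult_nonneg_nonneg mult_pos_pos intro: less_imp_le simp del: of_nat_Suc\<close>)
  qed
  have "radius A \<le> 1 / 2"
  proof -
    define X where "X = 1 / (1 - \<epsilon> / rmin) * (1 / (1 - 2 * \<epsilon> / m)) ^ (2 * (n - 1))"
    define B where "B = 1 / rmin * (max M R / m) ^ (n - 1) * (X - 1)"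
    have X: "1 \<le> X"
      using V(1) unfolding X_def dbound_def by blast
    then have B: "0 \<le> B"
      using \<rho>(1)[OF i] m0 M1 unfolding B_def by (intro mult_nonneg_nonneg zero_le_power) auto
    \<comment> \<open>Column by column, the radius half of \<open>dbound\<close> meets the weight of
      the exact factors; their sum over k is where 3^n arises.\<close>
    have "radius A \<le> (\<Sum>k<n. (B * of_nat (n choose Suc k)) * (2 * 2 ^ Suc k * cmax ^ n))"
      unfolding A_def radius_multiplicity_disks[of c i' n, OF c0 i'(2)] i'(1)[symmetric]
    proof (intro sum_mono mult_mono H)
      fix k assume "k \<in> {..<n}"
      then show "(\<Sum>l<n. cmod (inv_mat (C_mat n c) $$ (k, l)) * of_nat (Suc l) * real_of_int \<bar>c (Suc l)\<bar>)
          \<le> 2 * 2 ^ Suc k * cmax ^ n"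
        using C by (intro sum_C_inv_c_le[where c = c, OF c0 C1]) auto
      show "radius (V0_inv_entry n D i k) \<le> B * of_nat (n choose Suc k)"
        using V(1)[of k] by (simp add: dbound_def B_def X_def mult_ac)
    qed (use B in auto)
    also have "\<dots> = B * 2 * cmax ^ n * (\<Sum>k<n. of_nat (n choose Suc k) * 2 ^ Suc k)"
      unfolding sum_distrib_left by (intro sum.cong refl) (simp only: mult_ac)
    also have "\<dots> \<le> B * 2 * cmax ^ n * 3 ^ n"
      using B C1 by (intro mult_left_mono sum_choose_Suc_power2) auto
    also have "\<dots> = B * 2 * 3 ^ n * cmax ^ n"
      by (simp only: mult_ac)
    also have "\<dots> < 1 / 2"
      using est(3) unfolding B_def X_def .
    finally show ?thesis by simp
  qed
  \<comment> \<open>Positivity of the radius upgrades \<open>approx\<close> to strict membership in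
    the open ball.\<close>
  moreover have "of_int (int (order (r i) (cpoly p))) \<in> disk_set A"
    using approx_A \<open>0 < radius A\<close> by (simp add: disk_set_def approx_def dist_norm norm_minus_commute)
  ultimately have "\<exists>!k::int. of_int k \<in> disk_set A"
    by (intro ex1_int_in_disk_set)
  then show "of_nat (order (r i) (map_poly of_int p)) =
       (inv_mat (Lambda_mat n * C_mat n c * V0_mat n r) *\<^sub>v c_vec n c) $ (i - 1) \<and>
     (\<exists>!k::int. of_int k \<in> disk_set (multiplicity_disks n c (\<lambda>j. Disk (r j) \<epsilon>) $ (i - 1)))"
    using exact_value(1) unfolding A_def D_def i'(1) by simp
qed

end
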